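(* For every $n \ge 2$, the hyperoctahedral group $B_n$, naturally embedded in the symmetric group $S_{2n}$, is a non-modular, quasi-modular subgroup of $S_{2n}$.
   Context: $S_{2n}$ is the group of all permutations of $\Omega_n := \{1,-1,2,-2,\dots,n,-n\}$, a Coxeter group whose set of reflections is the set of transpositions. The natural embedding of the hyperoctahedral group $B_n$ in $S_{2n}$ maps the Coxeter generators of $B_n$ to the transposition $(n\ {-n})$ and the products $(i\ \ i+1)(-i\ \ {-i-1})$ for $1 \le i \le n-1$; its image consists of all permutations $w$ of $\Omega_n$ with $w(-i) = -w(i)$ for all $i$. Under this embedding the set of reflections $T(B_n)$ of the Coxeter group $B_n$ corresponds to the set of all $(i\ {-i})$ for $1 \le i \le n$, and $(i\ j)(-i\ {-j})$, $(i\ {-j})(-i\ j)$ for $1 \le i < j \le n$. For a Coxeter group $W$ with set of reflections $T=T(W)$, $\ell_T(w)$ is the minimum $k$ such that $w$ is a product of $k$ elements of $T$, and $\mathrm{Abs}(W)=(W,\le_T)$ is the partial order with $u \le_T v$ iff $\ell_T(vu^{-1}) = \ell_T(v) - \ell_T(u)$. A subgroup $H$ of $W$ is modular if every left coset of $H$ in $W$ has a minimum element in $\mathrm{Abs}(W)$. A subgroup $H$ of a finite Coxeter group $W$ is quasi-modular if $H$ is isomorphic to a Coxeter group and $$W_T(q) = H_{T(H)}(q) \cdot X_T(q),$$ where $T = T(W)$, $T(H)$ is the subset of $H$ corresponding to the set of reflections of this Coxeter group, $W_T(q) = \sum_{w \in W} q^{\ell_T(w)}$, $H_{T(H)}(q)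 = \sum_{h \in H} q^{\ell_{T(H)}(h)}$ with $\ell_{T(H)}(h)$ the minimum $k$ such that $h$ is a product of $k$ elements of $T(H)$, and $X_T(q) = \sum_{x \in X} q^{\ell_T(x)}$ with $X = W/H$ the set of left cosets and $\ell_T(x) = \min\{\ell_T(w) : w \in x\}$. *)

theory Defs
  imports
    "HOL-Algebra.Left_Coset"
    "HOL-Algebra.Generated_Groups"
    "HOL-Combinatorics.Permutations"
    "HOL-Computational_Algebra.Polynomial"
    "HOL-Library.Extended_Nat"
begin

section \<open>Coxeter groups\<close>

definition coxeter_matrix :: "'a set \<Rightarrow> ('a \<Rightarrow> 'a \<Rightarrow> enat) \<Rightarrow> bool" where
  "coxeter_matrix S m \<longleftrightarrow>
     (\<forall>s\<in>S. m s s = 1) \<and>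
     (\<forall>s\<in>S. \<forall>t\<in>S. m s t = m t s) \<and>
     (\<forall>s\<in>S. \<forall>t\<in>S. s \<noteq> t \<longrightarrow> m s t \<ge> 2)"

text \<open>Equality of words in the group presented by the generators \<open>S\<close> and the relations
  \<open>(s t) ^ m s t = 1\<close> for finite \<open>m s t\<close>. Because \<open>m s s = 1\<close> makes every generator an
  involution, words without formal inverses suffice: the words in \<open>S\<close> modulo this congruence
  are the presented group.\<close>

inductive coxeter_eq :: "'a set \<Rightarrow> ('a \<Rightarrow> 'a \<Rightarrow> enat) \<Rightarrow> 'a list \<Rightarrow> 'a list \<Rightarrow> bool"
  for S :: "'a set" and m :: "'a \<Rightarrow> 'a \<Rightarrow> enat" where
  refl: "u \<in> lists S \<Longrightarrow> coxeter_eq S m u u"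
| sym: "coxeter_eq S m u v \<Longrightarrow> coxeter_eq S m v u"
| trans: "coxeter_eq S m u v \<Longrightarrow> coxeter_eq S m v w \<Longrightarrow> coxeter_eq S m u w"
| rel: "s \<in> S \<Longrightarrow> t \<in> S \<Longrightarrow> m s t = enat k \<Longrightarrow> u \<in> lists S \<Longrightarrow> v \<in> lists S \<Longrightarrow>
    coxeter_eq S m (u @ concat (replicate k [s, t]) @ v) (u @ v)"

definition word_prod :: "'a monoid \<Rightarrow> 'a list \<Rightarrow> 'a" where
  "word_prod G ws = foldr (\<lambda>s w. s \<otimes>\<^bsub>G\<^esub> w) ws \<one>\<^bsub>G\<^esub>"

text \<open>\<open>G\<close> is a Coxeter group with Coxeter generators \<open>S\<close>: it is generated by \<open>S\<close>, and two words
  in \<open>S\<close> have the same value in \<open>G\<close> exactly when they are equal in the presented group.\<close>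

definition coxeter_system :: "'a monoid \<Rightarrow> 'a set \<Rightarrow> bool" where
  "coxeter_system G S \<longleftrightarrow>
     group G \<and> S \<subseteq> carrier G \<and> generate G S = carrier G \<and>
     (\<exists>m. coxeter_matrix S m \<and>
        (\<forall>u\<in>lists S. \<forall>v\<in>lists S. word_prod G u = word_prod G v \<longleftrightarrow> coxeter_eq S m u v))"

definition reflections :: "'a monoid \<Rightarrow> 'a set \<Rightarrow> 'a set" where
  "reflections G S = {w \<otimes>\<^bsub>G\<^esub> s \<otimes>\<^bsub>G\<^esub> inv\<^bsub>G\<^esub> w | w s. w \<in> carrier G \<and> s \<in> S}"


section \<open>Absolute length, absolute order and modularity\<close>

definition abs_length :: "'a monoid \<Rightarrow> 'a set \<Rightarrow> 'a \<Rightarrow> nat" where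
  "abs_length G T w = (LEAST k. \<exists>ts\<in>lists T. length ts = k \<and> word_prod G ts = w)"

definition abs_le :: "'a monoid \<Rightarrow> 'a set \<Rightarrow> 'a \<Rightarrow> 'a \<Rightarrow> bool" where
  "abs_le G T u v \<longleftrightarrow>
     int (abs_length G T (v \<otimes>\<^bsub>G\<^esub> inv\<^bsub>G\<^esub> u)) = int (abs_length G T v) - int (abs_length G T u)"

definition modular :: "'a monoid \<Rightarrow> 'a set \<Rightarrow> 'a set \<Rightarrow> bool" where
  "modular G S H \<longleftrightarrow>
     (\<forall>X\<in>lcosets\<^bsub>G\<^esub> H. \<exists>x\<in>X. \<forall>y\<in>X. abs_le G (reflections G S) x y)"

definition length_poly :: "'b set \<Rightarrow> ('b \<Rightarrow> nat) \<Rightarrow> int poly" where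
  "length_poly A l = (\<Sum>a\<in>A. monom 1 (l a))"

definition coset_length :: "'a monoid \<Rightarrow> 'a set \<Rightarrow> 'a set \<Rightarrow> nat" where
  "coset_length G T X = Min (abs_length G T ` X)"

text \<open>The set \<open>T(H)\<close> depends on how \<open>H\<close> is identified with a Coxeter group. Here the
  identification is an isomorphism \<open>\<phi>\<close> from the group \<open>C\<close> with Coxeter generators \<open>R\<close> onto \<open>H\<close>.\<close>

definition quasi_modular_via ::
  "'a monoid \<Rightarrow> 'a set \<Rightarrow> 'a set \<Rightarrow> 'b monoid \<Rightarrow> 'b set \<Rightarrow> ('b \<Rightarrow> 'a) \<Rightarrow> bool" where
  "quasi_modular_via G S H C R \<phi> \<longleftrightarrow>
     coxeter_system G S \<and> finite (carrier G) \<and> subgroup H G \<and>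
     coxeter_system C R \<and> \<phi> \<in> iso C (G\<lparr>carrier := H\<rparr>) \<and>
     (let T = reflections G S; T\<^sub>H = \<phi> ` reflections C R in
        length_poly (carrier G) (abs_length G T) =
        length_poly H (abs_length (G\<lparr>carrier := H\<rparr>) T\<^sub>H) *
        length_poly (lcosets\<^bsub>G\<^esub> H) (coset_length G T))"

text \<open>Any Coxeter group isomorphic to \<open>H\<close> has a copy on the element type of \<open>G\<close>, so taking
  \<open>C\<close> there loses nothing.\<close>

definition quasi_modular :: "'a monoid \<Rightarrow> 'a set \<Rightarrow> 'a set \<Rightarrow> bool" where
  "quasi_modular G S H \<longleftrightarrow> (\<exists>(C :: 'a monoid) R \<phi>. quasi_modular_via G S H C R \<phi>)"


section \<open>The hyperoctahedral group in the symmetric group\<close>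

definition Omega :: "nat \<Rightarrow> int set" where
  "Omega n = {- int n..int n} - {0}"

definition sym_Omega :: "nat \<Rightarrow> (int \<Rightarrow> int) monoid" where
  "sym_Omega n = \<lparr>carrier = {p. p permutes Omega n}, monoid.mult = (\<circ>), one = id\<rparr>"

text \<open>The transpositions of neighbours in \<open>-n < \<dots> < -1 < 1 < \<dots> < n\<close>; their conjugates are all
  the transpositions of \<open>Omega n\<close>.\<close>

definition sym_Omega_gens :: "nat \<Rightarrow> (int \<Rightarrow> int) set" where
  "sym_Omega_gens n =
     {transpose i j | i j. i \<in> Omega n \<and> j \<in> Omega n \<and> i < j \<and> (\<forall>k\<in>Omega n. \<not> (i < k \<and> k < j))}"

definition hyperoctahedral :: "nat \<Rightarrow> (int \<Rightarrow> int) set" where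
  "hyperoctahedral n = {w. w permutes Omega n \<and> (\<forall>i\<in>Omega n. w (- i) = - w i)}"

definition hyperoctahedral_group :: "nat \<Rightarrow> (int \<Rightarrow> int) monoid" where
  "hyperoctahedral_group n = \<lparr>carrier = hyperoctahedral n, monoid.mult = (\<circ>), one = id\<rparr>"

definition hyperoctahedral_gens :: "nat \<Rightarrow> (int \<Rightarrow> int) set" where
  "hyperoctahedral_gens n =
     insert (transpose (int n) (- int n))
       {transpose i (i + 1) \<circ> transpose (- i) (- i - 1) | i. 1 \<le> i \<and> i \<le> int n - 1}"

end

theory Submission
  imports Defs
begin

text \<open>Factoring a product of reflections through the point \<open>x\<close> as \<open>u \<circ> r\<close>, with \<open>u\<close> fixing \<open>x\<close> and
  \<open>r\<close> the identity or a reflection moving \<open>x\<close>, shows that the absolute length generating functions are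
  \<open>(1 + q)(1 + 2q)\<dots>(1 + (2n - 1)q)\<close> for \<open>S\<^sub>2\<^sub>n\<close> and \<open>(1 + q)(1 + 3q)\<dots>(1 + (2n - 1)q)\<close> for \<open>B\<^sub>n\<close>. A coset
  \<open>g B\<^sub>n\<close> is the same as the perfect matching \<open>g \<tau> g\<inverse>\<close> with \<open>\<tau> i = - i\<close>, and the length of
  \<open>g \<tau> g\<inverse> \<tau>\<close> is at most twice the length of any element of the coset. Explicit coset representatives
  attain this bound, which gives \<open>(1 + 2q)(1 + 4q)\<dots>(1 + (2n - 2)q)\<close> for the cosets. The coset of
  \<open>(1 2)\<close> has no minimum because it also contains \<open>(-1 -2)\<close>.\<close>

section \<open>Lengths of compositions of reflections\<close>

text \<open>The factor two arises because \<open>g \<tau> g^-1 \<tau>\<close> is \<open>g\<close>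
  times the conjugate of its inverse by \<open>\<tau>\<close>, and both have the length of
  \<open>g\<close>; elements of the subgroup commute with \<open>\<tau>\<close> and drop out. This
  gives a lower bound for a whole coset at once, which matters because no minimum of the coset in
  the absolute order can be relied on. The three products fit together because the coefficients 0,
  ..., 2n - 1 split into the odd ones, for the subgroup, and the even ones, for the cosets.
  Quasi-modularity also demands that both groups be Coxeter systems, so equal values must force
  equality in the presented group. The second half settles this for both types together, as both
  graphs are paths. Every word is rewritten, by the relations alone, into a concatenation of
  suffixes, one for each initial segment of the path; the last suffix can be read off from the
  preimage of one point, so different normal forms have different values. Neither the order of the
  presented group nor confluence of the rewriting enters.\<close>

definition comp_list :: "('a \<Rightarrow> 'a) list \<Rightarrow> 'a \<Rightarrow> 'a" where
  "comp_list ts = foldr (\<circ>) ts id"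

text \<open>The absolute length without the monoid argument: both groups multiply by composition, so
  only the set of reflections distinguishes the two length functions. If \<open>w\<close> is not a
  product over \<open>T\<close>, the value is unspecified, hence the later hypotheses that
  \<open>w\<close> lies in the image of \<open>comp_list\<close>.\<close>

definition comp_length :: "('a \<Rightarrow> 'a) set \<Rightarrow> ('a \<Rightarrow> 'a) \<Rightarrow> nat" where
  "comp_length T w = (LEAST k. \<exists>ts\<in>lists T. length ts = k \<and> comp_list ts = w)"

lemma comp_list_Nil [simp]: "comp_list [] = id"
  by (simp add: comp_list_def)

lemma comp_list_Cons [simp]: "comp_list (t # ts) = t \<circ> comp_list ts"
  by (simp add: comp_list_def)

lemma comp_list_append [simp]: "comp_list (ts @ us) = comp_list ts \<circ> comp_list us"
  by (induction ts) (simp_all add: o_assoc)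

lemma comp_length_le: "ts \<in> lists T \<Longrightarrow> comp_length T (comp_list ts) \<le> length ts"
  unfolding comp_length_def by (rule Least_le) blast

lemma comp_length_witness:
  assumes "w \<in> comp_list ` lists T"
  obtains ts where "ts \<in> lists T" "length ts = comp_length T w" "comp_list ts = w"
proof -
  have "\<exists>k. \<exists>ts\<in>lists T. length ts = k \<and> comp_list ts = w"
    using assms by blast
  from LeastI_ex[OF this] show thesis
    using that unfolding comp_length_def by blast
qed

lemma comp_length_id [simp]: "comp_length T id = 0"
  using comp_length_le[of "[]" T] by simp

lemma comp_length_eq_0:
  assumes "w \<in> comp_list ` lists T" "comp_length T w = 0"
  shows "w = id"
  using comp_length_witness[OF assms(1)] assms(2) by (metis length_0_conv comp_list_Nil)

lemma comp_length_member:
  assumes "t \<in> T" "t \<noteq> id"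
  shows "comp_length T t = 1"
proof -
  have t: "[t] \<in> lists T" "comp_list [t] = t" using assms(1) by auto
  then have "comp_length T t \<noteq> 0"
    using comp_length_eq_0[of t T] assms(2) by (metis image_eqI)
  then show ?thesis using comp_length_le[OF t(1)] t(2) by simp
qed

lemma comp_list_lists_mono: "T \<subseteq> T' \<Longrightarrow> comp_list ` lists T \<subseteq> comp_list ` lists T'"
  by (intro image_mono lists_mono)

lemma comp_list_lists_comp:
  assumes "v \<in> comp_list ` lists T" "w \<in> comp_list ` lists T"
  shows "v \<circ> w \<in> comp_list ` lists T"
proof -
  obtain ts us where "ts \<in> lists T" "us \<in> lists T" "v = comp_list ts" "w = comp_list us"
    using assms by blast
  then show ?thesis by (intro image_eqI[of _ _ "ts @ us"]) simp_all
qed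

lemma comp_list_fixes: "(\<And>t. t \<in> set ts \<Longrightarrow> t x = x) \<Longrightarrow> comp_list ts x = x"
  by (induction ts) auto

lemma comp_list_conj:
  assumes "s \<circ> s = id"
  shows "comp_list (map (\<lambda>t. s \<circ> t \<circ> s) ts) = s \<circ> comp_list ts \<circ> s"
proof (induction ts)
  case (Cons t ts)
  have "comp_list (map (\<lambda>t. s \<circ> t \<circ> s) (t # ts)) = s \<circ> t \<circ> (s \<circ> s) \<circ> comp_list ts \<circ> s"
    by (simp only: list.map comp_list_Cons Cons o_assoc)
  then show ?case by (simp only: assms comp_list_Cons o_assoc comp_id)
qed (simp add: assms)

lemma comp_list_rev:
  "(\<And>t. t \<in> set ts \<Longrightarrow> t \<circ> t = id) \<Longrightarrow> comp_list ts \<circ> comp_list (rev ts) = id"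
proof (induction ts)
  case (Cons t ts)
  have "comp_list (t # ts) \<circ> comp_list (rev (t # ts)) =
      t \<circ> (comp_list ts \<circ> comp_list (rev ts)) \<circ> t"
    by (simp add: o_assoc)
  then show ?case using Cons.IH Cons.prems by (simp only: list.set_intros comp_id)
qed simp

text \<open>Source of the linear factors: one choice of \<open>y\<close> costs nothing, each of the
  others costs one reflection.\<close>

lemma sum_monom_indicator:
  assumes "finite Y" "x \<in> Y"
  shows "(\<Sum>y\<in>Y. monom (1::int) (if y = x then 0 else 1)) = [:1, int (card Y) - 1:]"
proof -
  have "(\<Sum>y\<in>Y. monom (1::int) (if y = x then 0 else 1)) = 1 + (\<Sum>y\<in>Y - {x}. [:0, 1:])"
    using assms by (subst sum.remove[of Y x]) (auto intro!: sum.cong simp: monom_Suc monom_0 one_pCons)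
  also have "\<dots> = [:1, int (card (Y - {x})):]"
    by (simp add: of_nat_poly one_pCons)
  also have "int (card (Y - {x})) = int (card Y) - 1"
    using assms card_Suc_Diff1[OF assms] by linarith
  finally show ?thesis .
qed

text \<open>If \<open>r y\<close> sends \<open>y\<close> to \<open>x\<close>, a product \<open>w\<close> of reflections factors as \<open>u \<circ> r y\<close> with
  \<open>w y = x\<close> and \<open>u\<close> fixing \<open>x\<close>. The assumptions allow a reflection to be moved through \<open>r y\<close>
  without lengthening the product of reflections fixing \<open>x\<close>.\<close>

locale point_reflections =
  fixes T :: "('a \<Rightarrow> 'a) set" and x :: 'a and Y :: "'a set" and r :: "'a \<Rightarrow> 'a \<Rightarrow> 'a"
  assumes x_in: "x \<in> Y"
    and r_x: "r x = id"
    and r_in: "y \<in> Y \<Longrightarrow> y \<noteq> x \<Longrightarrow> r y \<in> T"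
    and r_y: "y \<in> Y \<Longrightarrow> r y y = x"
    and T_Y: "t \<in> T \<Longrightarrow> y \<in> Y \<Longrightarrow> t y \<in> Y"
    and invol: "t \<in> T \<Longrightarrow> t \<circ> t = id"
    and fixing: "t \<in> T \<Longrightarrow> t x = x \<Longrightarrow> y \<in> Y \<Longrightarrow> r y \<circ> t = t \<circ> r (t y)"
    and moving: "t \<in> T \<Longrightarrow> t x \<noteq> x \<Longrightarrow> t = r (t x)"
    and exchange: "y \<in> Y \<Longrightarrow> b \<in> Y \<Longrightarrow> y \<noteq> x \<Longrightarrow> b \<noteq> x \<Longrightarrow> y \<noteq> b \<Longrightarrow>
      \<exists>u\<in>T. u x = x \<and> r y \<circ> r b = u \<circ> r (r b y)"
begin

abbreviation "T' \<equiv> {t \<in> T. t x = x}"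

lemma inj_T: "t \<in> T \<Longrightarrow> inj t"
  using invol by (metis inj_on_id inj_on_imageI2)

lemma T_fixed: "t \<in> T \<Longrightarrow> t x = x \<Longrightarrow> t y = x \<longleftrightarrow> y = x"
  by (metis inj_T injD)

text \<open>The word is read from left to right while \<open>r y\<close> is kept at its right end. A
  new reflection \<open>t\<close> is moved past \<open>r y\<close> if it fixes \<open>x\<close>,
  becomes the moving factor if there is none, cancels against an equal one, and is otherwise
  absorbed by \<open>exchange\<close>. The number of factors grows by at most one each time.\<close>

lemma factorization:
  assumes "ts \<in> lists T"
  shows "\<exists>us\<in>lists T'. \<exists>y\<in>Y. comp_list ts = comp_list us \<circ> r y \<and>
    length us + (if y = x then 0 else 1) \<le> length ts"
  using assms
proof (induction ts rule: rev_induct)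
  case Nil
  show ?case using x_in r_x by (intro bexI[of _ "[]"] bexI[of _ x]) auto
next
  case (snoc t ts)
  then obtain us y where us: "us \<in> lists T'" "y \<in> Y" "comp_list ts = comp_list us \<circ> r y"
    "length us + (if y = x then 0 else 1) \<le> length ts" unfolding append_in_lists_conv by blast
  have t: "t \<in> T" using snoc.prems by auto
  have eq: "comp_list (ts @ [t]) = comp_list us \<circ> (r y \<circ> t)"
    by (simp add: us(3) o_assoc)
  consider "t x = x" | "t x \<noteq> x" "y = x" | "t x \<noteq> x" "y \<noteq> x" "y = t x"
    | "t x \<noteq> x" "y \<noteq> x" "y \<noteq> t x" by blast
  then show ?case
  proof cases
    case 1
    have "comp_list (ts @ [t]) = comp_list (us @ [t]) \<circ> r (t y)"
      unfolding eq using fixing[OF t 1 us(2)] by (simp add: o_assoc)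
    then show ?thesis
      using us 1 t T_Y[OF t us(2)] T_fixed[OF t 1, of y]
      by (intro bexI[of _ "us @ [t]"] bexI[of _ "t y"]) auto
  next
    case 2
    then have "comp_list (ts @ [t]) = comp_list us \<circ> r (t x)"
      unfolding eq using moving[OF t] by (simp add: r_x)
    then show ?thesis
      using us 2 T_Y[OF t x_in] by (intro bexI[of _ us] bexI[of _ "t x"]) auto
  next
    case 3
    then have "r y \<circ> t = id" using moving[OF t] invol[OF t] by simp
    then have "comp_list (ts @ [t]) = comp_list us \<circ> r x" unfolding eq by (simp add: r_x)
    then show ?thesis
      using us 3 x_in by (intro bexI[of _ us] bexI[of _ x]) auto
  next
    case 4
    obtain u where u: "u \<in> T" "u x = x" "r y \<circ> t = u \<circ> r (t y)"
      using exchange[OF us(2) T_Y[OF t x_in] 4(2,1,3)]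
      unfolding moving[OF t 4(1), symmetric] by blast
    have "comp_list (ts @ [t]) = comp_list (us @ [u]) \<circ> r (t y)"
      unfolding eq u(3) by (simp add: o_assoc)
    moreover have "us @ [u] \<in> lists T'" using us(1) u(1,2) by simp
    moreover have "length (us @ [u]) + (if t y = x then 0 else 1) \<le> length (ts @ [t])"
      using us(4) 4(2) by (auto split: if_splits)
    ultimately show ?thesis using T_Y[OF t us(2)] by blast
  qed
qed

lemma fixes_x: "u \<in> comp_list ` lists T' \<Longrightarrow> u x = x"
  by (auto intro!: comp_list_fixes)

lemma inj_r: "y \<in> Y \<Longrightarrow> inj (r y)"
  using r_in inj_T r_x by (cases "y = x") auto

lemma surj_r: "y \<in> Y \<Longrightarrow> surj (r y)"
  using r_in invol r_x by (metis surj_id surjI id_apply comp_apply)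

lemma inj_comp_list: "ts \<in> lists T \<Longrightarrow> inj (comp_list ts)"
  proof (induction ts)
  case (Cons t ts)
  then show ?case using inj_T[of t] inj_compose[of t "comp_list ts"]
    by (simp del: o_apply only: comp_list_Cons Cons_in_lists_iff)
qed simp

text \<open>Since the left factor fixes \<open>x\<close>, the point \<open>y\<close> is the preimage
  of \<open>x\<close> under the product; \<open>r y\<close> is then cancelled by
  surjectivity.\<close>

lemma factorization_unique:
  assumes "u \<in> comp_list ` lists T'" "v \<in> comp_list ` lists T'" "y \<in> Y" "z \<in> Y"
    and "u \<circ> r y = v \<circ> r z"
  shows "u = v \<and> y = z"
proof -
  have "v (r z y) = x"
    using fun_cong[OF assms(5), of y] r_y[OF assms(3)] fixes_x[OF assms(1)] by simp
  moreover have "v (r z z) = x" using r_y[OF assms(4)] fixes_x[OF assms(2)] by simp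
  moreover have "inj v" using assms(2) inj_comp_list by auto
  ultimately have "r z y = r z z" by (metis injD)
  then have yz: "y = z" using inj_r[OF assms(4)] by (simp add: inj_eq)
  then have "u = v" using assms(5) surj_r[OF assms(4)] by (metis surj_fun_eq)
  with yz show ?thesis by simp
qed

text \<open>For the lower bound, a shortest word of the product is put through
  \<open>factorization\<close>; uniqueness says that the factors found are \<open>u\<close> and
  \<open>r y\<close> themselves.\<close>

lemma comp_length_factorization:
  assumes u: "u \<in> comp_list ` lists T'" and y: "y \<in> Y"
  shows "comp_length T (u \<circ> r y) = comp_length T' u + (if y = x then 0 else 1)"
proof (rule antisym)
  obtain us where us: "us \<in> lists T'" "length us = comp_length T' u" "comp_list us = u"
    using comp_length_witness[OF u] .
  let ?ts = "us @ (if y = x then [] else [r y])"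
  have ts: "?ts \<in> lists T" "comp_list ?ts = u \<circ> r y" using us(1,3) r_in[OF y] r_x by auto
  then show "comp_length T (u \<circ> r y) \<le> comp_length T' u + (if y = x then 0 else 1)"
    using comp_length_le[OF ts(1)] us(2) by (auto split: if_splits)
  have "u \<circ> r y \<in> comp_list ` lists T" using ts by (metis imageI)
  then obtain vs where vs: "vs \<in> lists T" "length vs = comp_length T (u \<circ> r y)"
    "comp_list vs = u \<circ> r y" by (rule comp_length_witness)
  obtain us' z where z: "us' \<in> lists T'" "z \<in> Y" "u \<circ> r y = comp_list us' \<circ> r z"
    "length us' + (if z = x then 0 else 1) \<le> length vs"
    using factorization[OF vs(1)] unfolding vs(3) by blast
  have "u = comp_list us' \<and> y = z" using factorization_unique[OF u _ y z(2,3)] z(1) by blast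
  then show "comp_length T' u + (if y = x then 0 else 1) \<le> comp_length T (u \<circ> r y)"
    using z(4) vs(2) comp_length_le[OF z(1)] by (auto split: if_splits)
qed

text \<open>The case \<open>y = x\<close>: reflections that move \<open>x\<close> cannot shorten a
  product of reflections that fix it.\<close>

lemma comp_length_restrict: "u \<in> comp_list ` lists T' \<Longrightarrow> comp_length T u = comp_length T' u"
  using comp_length_factorization[OF _ x_in, of u] r_x by simp

text \<open>Uniqueness makes the pairs \<open>(u, y)\<close> a parametrization and the exponent is
  additive on them, so the sum factors. \<open>U\<close> is left free so that a group of
  permutations can be inserted directly.\<close>

lemma length_poly_extend:
  assumes "finite Y" "finite U" "U \<subseteq> comp_list ` lists T'"
  shows "length_poly {u \<circ> r y | u y. u \<in> U \<and> y \<in> Y} (comp_length T) =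
    [:1, int (card Y) - 1:] * length_poly U (comp_length T')"
proof -
  have inj: "inj_on (\<lambda>(u, y). u \<circ> r y) (U \<times> Y)"
  proof (rule inj_onI, clarsimp simp del: o_apply)
    fix u y v z
    assume "u \<in> U" "y \<in> Y" "v \<in> U" "z \<in> Y" "u \<circ> r y = v \<circ> r z"
    then show "u = v \<and> y = z" using factorization_unique[of u v y z] assms(3) by blast
  qed
  have img: "{u \<circ> r y | u y. u \<in> U \<and> y \<in> Y} = (\<lambda>(u, y). u \<circ> r y) ` (U \<times> Y)" by auto
  have "length_poly {u \<circ> r y | u y. u \<in> U \<and> y \<in> Y} (comp_length T) =
      (\<Sum>(u, y)\<in>U \<times> Y. monom 1 (comp_length T (u \<circ> r y)))"
    unfolding length_poly_def img by (subst sum.reindex[OF inj]) (simp add: case_prod_unfold)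
  also have "\<dots> = (\<Sum>(u, y)\<in>U \<times> Y. monom 1 (comp_length T' u) * monom 1 (if y = x then 0 else 1))"
    using assms(3) comp_length_factorization
    by (intro sum.cong) (simp_all add: subset_iff mult_monom case_prod_unfold mem_Times_iff)
  also have "\<dots> = length_poly U (comp_length T') * (\<Sum>y\<in>Y. monom 1 (if y = x then 0 else 1))"
    unfolding length_poly_def sum_product by (simp only: sum.cartesian_product)
  finally show ?thesis using sum_monom_indicator[OF assms(1) x_in] by (simp add: mult.commute)
qed

end

section \<open>The generating functions of the two groups\<close>

definition transpositions :: "'a set \<Rightarrow> ('a \<Rightarrow> 'a) set" where
  "transpositions D = {transpose i j | i j. i \<in> D \<and> j \<in> D \<and> i \<noteq> j}"

lemma in_transpositions: "i \<in> D \<Longrightarrow> j \<in> D \<Longrightarrow> i \<noteq> j \<Longrightarrow> transpose i j \<in> transpositions D"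
  unfolding transpositions_def by blast

lemma transpositions_fixing:
  "{t \<in> transpositions D. t x = x} = transpositions (D - {x})"
proof (intro equalityI subsetI)
  fix t assume "t \<in> {t \<in> transpositions D. t x = x}"
  then obtain i j where ij: "t = transpose i j" "i \<in> D" "j \<in> D" "i \<noteq> j" "transpose i j x = x"
    unfolding transpositions_def by auto
  then have "x \<noteq> i" "x \<noteq> j" by auto
  then show "t \<in> transpositions (D - {x})" using ij unfolding transpositions_def by blast
qed (auto simp: transpositions_def)

lemma inj_comp_transpose: "inj w \<Longrightarrow> w \<circ> transpose i j = transpose (w i) (w j) \<circ> w"
  by (auto simp: fun_eq_iff transpose_def inj_eq)

lemma point_reflections_transpositions:
  assumes "x \<in> D"
  shows "point_reflections (transpositions D) x D (transpose x)"
proof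
  fix y b assume "y \<in> D" "b \<in> D" "y \<noteq> x" "b \<noteq> x" "y \<noteq> b"
  then show "\<exists>u\<in>transpositions D. u x = x \<and>
      transpose x y \<circ> transpose x b = u \<circ> transpose x (transpose x b y)"
    by (intro bexI[of _ "transpose y b"])
      (auto simp: transpositions_def fun_eq_iff transpose_def)
next
  fix t y assume t: "t \<in> transpositions D" "t x = x" "y \<in> D"
  then have "inj t" "t (t y) = y" by (auto simp: transpositions_def)
  then show "transpose x y \<circ> t = t \<circ> transpose x (t y)"
    using inj_comp_transpose[of t x "t y"] t(2) by simp
next
  fix t assume "t \<in> transpositions D"
  then show "t \<circ> t = id" unfolding transpositions_def by auto
next
  fix t assume "t \<in> transpositions D" "t x \<noteq> x"
  then obtain i j where ij: "t = transpose i j" "transpose i j x \<noteq> x"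
    unfolding transpositions_def by auto
  then have "x = i \<or> x = j" by (metis transpose_apply_other)
  then show "t = transpose x (t x)" using ij(1) by (auto simp: transpose_commute)
next
  fix t y assume "t \<in> transpositions D" "y \<in> D"
  then show "t y \<in> D" unfolding transpositions_def by (auto simp: transpose_def)
next
  fix y assume "y \<in> D" "y \<noteq> x"
  then show "transpose x y \<in> transpositions D" unfolding transpositions_def using assms by blast
qed (use assms in simp_all)

lemma permutes_insert_transpose:
  assumes "x \<notin> D"
  shows "{p. p permutes insert x D} =
    {u \<circ> transpose x y | u y. u \<in> {p. p permutes D} \<and> y \<in> insert x D}" (is "?L = ?R")
proof (intro equalityI subsetI)
  fix p assume "p \<in> ?L"
  then have p: "p permutes insert x D" by simp
  define y where "y = (inv_into UNIV p) x"
  have y: "y \<in> insert x D" "p y = x"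
    unfolding y_def using permutes_in_image[OF permutes_inv[OF p], of x] permutes_inverses(1)[OF p]
    by simp_all
  have "p \<circ> transpose x y permutes insert x D"
    using y p by (intro permutes_compose permutes_swap_id) auto
  then have "p \<circ> transpose x y permutes D"
    by (rule permutes_superset) (use y(2) in auto)
  moreover have "p = (p \<circ> transpose x y) \<circ> transpose x y"
    by (simp add: fun_eq_iff)
  ultimately show "p \<in> ?R" using y(1) by blast
next
  fix p assume "p \<in> ?R"
  then obtain u y where "p = u \<circ> transpose x y" "u permutes D" "y \<in> insert x D" by auto
  then show "p \<in> ?L"
    using permutes_subset[of u D "insert x D"]
    by (auto intro!: permutes_compose[of "transpose x y"] permutes_swap_id)
qed

lemma permutes_subset_comp_list:
  "finite D \<Longrightarrow> {p. p permutes D} \<subseteq> comp_list ` lists (transpositions D)"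
proof (induction rule: finite_induct)
  case empty
  then show ?case by (auto intro: image_eqI[of _ _ "[]"])
next
  case (insert x D)
  interpret point_reflections "transpositions (insert x D)" x "insert x D" "transpose x"
    by (rule point_reflections_transpositions) simp
  show ?case
  proof
    fix p assume "p \<in> {p. p permutes insert x D}"
    then obtain u y where p: "p = u \<circ> transpose x y" "u permutes D" "y \<in> insert x D"
      unfolding permutes_insert_transpose[OF insert.hyps(2)] by auto
    have "transpositions D \<subseteq> transpositions (insert x D)" by (auto simp: transpositions_def)
    then have u: "u \<in> comp_list ` lists (transpositions (insert x D))"
      using insert.IH p(2) by (blast dest: comp_list_lists_mono)
    have "transpose x y \<in> comp_list ` lists (transpositions (insert x D))"
    proof (cases "y = x")
      case True
      then show ?thesis by (auto intro: image_eqI[of _ _ "[]"])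
    next
      case False
      then show ?thesis using r_in[OF p(3)] by (auto intro: image_eqI[of _ _ "[transpose x y]"])
    qed
    then show "p \<in> comp_list ` lists (transpositions (insert x D))"
      unfolding p(1) using u by (rule comp_list_lists_comp[rotated])
  qed
qed

lemma length_poly_permutes:
  "finite D \<Longrightarrow> length_poly {p. p permutes D} (comp_length (transpositions D)) =
    (\<Prod>i<card D. [:1, int i:])"
proof (induction rule: finite_induct)
  case empty
  then show ?case by (simp add: length_poly_def)
next
  case (insert x D)
  interpret point_reflections "transpositions (insert x D)" x "insert x D" "transpose x"
    by (rule point_reflections_transpositions) simp
  have T': "T' = transpositions D"
    unfolding transpositions_fixing using insert.hyps(2) by simp
  show ?case
    unfolding permutes_insert_transpose[OF insert.hyps(2)]
    using insert length_poly_extend[of "{p. p permutes D}"] permutes_subset_comp_list[OF insert.hyps(1)]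
    unfolding T' by (simp add: finite_permutations mult.commute)
qed

text \<open>One formula for all reflections of the hyperoctahedral group: the product of
  \<open>(i j)\<close> and \<open>(-i -j)\<close> in general, the single transposition
  \<open>(i -i)\<close> if \<open>j = - i\<close>.\<close>

definition signed_swap :: "int \<Rightarrow> int \<Rightarrow> int \<Rightarrow> int" where
  "signed_swap i j k = (if k = i then j else if k = j then i
     else if k = - i then - j else if k = - j then - i else k)"

definition signed_swaps :: "nat \<Rightarrow> (int \<Rightarrow> int) set" where
  "signed_swaps n = {signed_swap i j | i j. i \<in> Omega n \<and> j \<in> Omega n \<and> i \<noteq> j}"

lemma in_signed_swaps: "i \<in> Omega n \<Longrightarrow> j \<in> Omega n \<Longrightarrow> i \<noteq> j \<Longrightarrow> signed_swap i j \<in> signed_swaps n"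
  unfolding signed_swaps_def by blast

lemma Omega_iff: "i \<in> Omega n \<longleftrightarrow> - int n \<le> i \<and> i \<le> int n \<and> i \<noteq> 0"
  by (auto simp: Omega_def)

lemma finite_Omega [simp]: "finite (Omega n)"
  by (simp add: Omega_def)

lemma card_Omega [simp]: "card (Omega n) = 2 * n"
proof -
  have "card (Omega n) = card {- int n..int n} - card {0::int}"
    unfolding Omega_def by (rule card_Diff_subset) auto
  then show ?thesis by simp
qed

lemma uminus_Omega_iff [simp]: "- i \<in> Omega n \<longleftrightarrow> i \<in> Omega n"
  by (auto simp: Omega_iff)

lemma Omega_nonzero: "i \<in> Omega n \<Longrightarrow> i \<noteq> 0"
  by (simp add: Omega_iff)

lemma signed_swap_minus: "i \<noteq> 0 \<Longrightarrow> j \<noteq> 0 \<Longrightarrow> signed_swap i j (- k) = - signed_swap i j k"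
  by (auto simp: signed_swap_def)

lemma signed_swap_invol: "i \<noteq> 0 \<Longrightarrow> j \<noteq> 0 \<Longrightarrow> signed_swap i j (signed_swap i j k) = k"
  by (auto simp: signed_swap_def)

lemma signed_swap_self: "signed_swap i i = id"
  by (auto simp: signed_swap_def fun_eq_iff)

lemma signed_swap_Omega: "i \<in> Omega n \<Longrightarrow> j \<in> Omega n \<Longrightarrow> k \<in> Omega n \<Longrightarrow> signed_swap i j k \<in> Omega n"
  by (simp add: signed_swap_def)

lemma comp_signed_swap:
  assumes "inj w" "\<And>k. w (- k) = - w k"
  shows "w \<circ> signed_swap i j = signed_swap (w i) (w j) \<circ> w"
proof
  fix k
  have "k = - i \<longleftrightarrow> w k = - w i" "k = - j \<longleftrightarrow> w k = - w j"
    using assms by (metis injD)+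
  then show "(w \<circ> signed_swap i j) k = (signed_swap (w i) (w j) \<circ> w) k"
    unfolding signed_swap_def using assms(2) inj_eq[OF assms(1)] by simp
qed

lemma signed_swaps_fixing:
  "{t \<in> signed_swaps (Suc n). t (int (Suc n)) = int (Suc n)} = signed_swaps n"
proof (intro equalityI subsetI)
  fix t assume "t \<in> {t \<in> signed_swaps (Suc n). t (int (Suc n)) = int (Suc n)}"
  then obtain i j where ij: "t = signed_swap i j" "i \<in> Omega (Suc n)" "j \<in> Omega (Suc n)" "i \<noteq> j"
    "signed_swap i j (int (Suc n)) = int (Suc n)"
    unfolding signed_swaps_def by auto
  then have "int (Suc n) \<notin> {i, j, - i, - j}"
    by (auto simp: signed_swap_def split: if_splits)
  then have "i \<in> Omega n" "j \<in> Omega n" using ij(2,3) by (auto simp: Omega_iff)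
  then show "t \<in> signed_swaps n" using ij unfolding signed_swaps_def by blast
next
  fix t assume "t \<in> signed_swaps n"
  then obtain i j where ij: "t = signed_swap i j" "i \<in> Omega n" "j \<in> Omega n" "i \<noteq> j"
    unfolding signed_swaps_def by auto
  then have "i \<in> Omega (Suc n)" "j \<in> Omega (Suc n)" "t (int (Suc n)) = int (Suc n)"
    by (auto simp: Omega_iff signed_swap_def)
  then show "t \<in> {t \<in> signed_swaps (Suc n). t (int (Suc n)) = int (Suc n)}"
    using ij unfolding signed_swaps_def by auto
qed

text \<open>With \<open>y' = signed_swap x b y\<close>, the left factor is forced. If
  \<open>y\<close> is neither \<open>- b\<close> nor \<open>- x\<close>, then \<open>y' = y\<close>
  and the factor is the conjugate of \<open>signed_swap x b\<close> by
  \<open>signed_swap x y\<close>, which is a sign change at \<open>y\<close> when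
  \<open>b = - x\<close>. If \<open>b = - y\<close> or \<open>y = - x\<close>, then
  \<open>y'\<close> is \<open>- x\<close> or \<open>- b\<close>, and a sign change at
  \<open>b\<close> remains.\<close>

lemma signed_swap_exchange:
  assumes "x \<noteq> 0" "y \<noteq> 0" "b \<noteq> 0" "y \<noteq> x" "b \<noteq> x" "y \<noteq> b"
  shows "signed_swap x y \<circ> signed_swap x b =
    (if b = - y \<or> y = - x then signed_swap b (- b)
     else if b = - x then signed_swap y (- y) else signed_swap y b) \<circ>
    signed_swap x (signed_swap x b y)"
proof
  fix k
  show "(signed_swap x y \<circ> signed_swap x b) k =
      ((if b = - y \<or> y = - x then signed_swap b (- b)
       else if b = - x then signed_swap y (- y) else signed_swap y b) \<circ>
      signed_swap x (signed_swap x b y)) k"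
    using assms unfolding comp_apply signed_swap_def by (smt (verit))
qed

lemma point_reflections_signed_swaps:
  assumes x: "x \<in> Omega n"
  shows "point_reflections (signed_swaps n) x (Omega n) (signed_swap x)"
proof
  fix y b assume yb: "y \<in> Omega n" "b \<in> Omega n" "y \<noteq> x" "b \<noteq> x" "y \<noteq> b"
  let ?u = "if b = - y \<or> y = - x then signed_swap b (- b)
     else if b = - x then signed_swap y (- y) else signed_swap y b"
  have "?u \<in> signed_swaps n"
    using yb Omega_nonzero[OF yb(1)] Omega_nonzero[OF yb(2)] in_signed_swaps[of _ n]
    by (simp add: eq_neg_iff_add_eq_0)
  moreover have "?u x = x"
    using yb Omega_nonzero[OF yb(1)] Omega_nonzero[OF yb(2)] Omega_nonzero[OF x]
    by (auto simp: signed_swap_def)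
  ultimately show "\<exists>u\<in>signed_swaps n. u x = x \<and>
      signed_swap x y \<circ> signed_swap x b = u \<circ> signed_swap x (signed_swap x b y)"
    using signed_swap_exchange[of x y b] yb x Omega_nonzero by blast
next
  fix t y assume t: "t \<in> signed_swaps n" "t x = x" "y \<in> Omega n"
  then obtain i j where ij: "t = signed_swap i j" "i \<noteq> 0" "j \<noteq> 0"
    unfolding signed_swaps_def using Omega_nonzero by blast
  have tt: "t (t k) = k" for k using signed_swap_invol ij by simp
  then have "inj t" by (rule inj_on_inverseI)
  moreover have "t (- k) = - t k" for k using signed_swap_minus ij by simp
  ultimately have "t \<circ> signed_swap x (t y) = signed_swap (t x) (t (t y)) \<circ> t"
    by (rule comp_signed_swap)
  then show "signed_swap x y \<circ> t = t \<circ> signed_swap x (t y)" by (simp only: tt t(2))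
next
  fix t assume t: "t \<in> signed_swaps n" "t x \<noteq> x"
  then obtain i j where "t = signed_swap i j" "i \<noteq> 0" "j \<noteq> 0" "x \<noteq> 0"
    unfolding signed_swaps_def using Omega_nonzero x by blast
  then show "t = signed_swap x (t x)"
    using t(2) unfolding fun_eq_iff signed_swap_def by (smt (verit))
next
  fix t assume "t \<in> signed_swaps n"
  then obtain i j where "t = signed_swap i j" "i \<noteq> 0" "j \<noteq> 0"
    unfolding signed_swaps_def using Omega_nonzero by blast
  then show "t \<circ> t = id"
    using signed_swap_invol by (simp add: fun_eq_iff)
next
  fix t y assume "t \<in> signed_swaps n" "y \<in> Omega n"
  then show "t y \<in> Omega n"
    unfolding signed_swaps_def using signed_swap_Omega by blast
next
  fix y assume "y \<in> Omega n" "y \<noteq> x"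
  then show "signed_swap x y \<in> signed_swaps n" using x unfolding signed_swaps_def by blast
qed (use x in \<open>auto simp: signed_swap_def signed_swap_self\<close>)

section \<open>The hyperoctahedral group as a chain of point stabilizers\<close>

lemma hyperoctahedral_minus: "w \<in> hyperoctahedral n \<Longrightarrow> w (- i) = - w i"
  using permutes_not_in[of w "Omega n"] uminus_Omega_iff[of i n]
  by (cases "i \<in> Omega n") (auto simp: hyperoctahedral_def)

lemma hyperoctahedral_iff:
  "w \<in> hyperoctahedral n \<longleftrightarrow> w permutes Omega n \<and> (\<forall>i. w (- i) = - w i)"
  using hyperoctahedral_minus by (auto simp: hyperoctahedral_def)

lemma signed_swap_hyperoctahedral:
  assumes "i \<in> Omega n" "j \<in> Omega n"
  shows "signed_swap i j \<in> hyperoctahedral n"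
proof -
  have "signed_swap i j permutes Omega n"
    unfolding permutes_def
  proof (intro conjI allI impI ex_ex1I)
    fix k assume "k \<notin> Omega n"
    then show "signed_swap i j k = k"
      using assms by (auto simp: signed_swap_def)
  next
    fix k show "\<exists>l. signed_swap i j l = k"
      using signed_swap_invol assms Omega_nonzero by metis
  next
    fix k l m assume "signed_swap i j l = k" "signed_swap i j m = k"
    then show "l = m" using signed_swap_invol assms Omega_nonzero by metis
  qed
  then show ?thesis
    using signed_swap_minus assms Omega_nonzero by (simp add: hyperoctahedral_iff)
qed

lemma hyperoctahedral_comp:
  "v \<in> hyperoctahedral n \<Longrightarrow> w \<in> hyperoctahedral n \<Longrightarrow> v \<circ> w \<in> hyperoctahedral n"
  by (auto simp: hyperoctahedral_iff intro: permutes_compose)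

lemma hyperoctahedral_inv:
  assumes "w \<in> hyperoctahedral n"
  shows "(inv_into UNIV w) \<in> hyperoctahedral n"
proof -
  have p: "w permutes Omega n" using assms by (simp add: hyperoctahedral_iff)
  have "(inv_into UNIV w) (- i) = - (inv_into UNIV w) i" for i
  proof -
    have "w (- (inv_into UNIV w) i) = - i"
      using hyperoctahedral_minus[OF assms] permutes_inverses(1)[OF p] by simp
    then show ?thesis using permutes_inv_eq[OF p] by blast
  qed
  then show ?thesis using permutes_inv[OF p] by (simp add: hyperoctahedral_iff)
qed

text \<open>By oddness, fixing \<open>n + 1\<close> also fixes \<open>- (n + 1)\<close>, so
  stabilizing a single point goes down one rank.\<close>

lemma hyperoctahedral_Suc_iff:
  "w \<in> hyperoctahedral n \<longleftrightarrow>
    w \<in> hyperoctahedral (Suc n) \<and> w (int (Suc n)) = int (Suc n)"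
proof
  assume w: "w \<in> hyperoctahedral n"
  have "Omega n \<subseteq> Omega (Suc n)" "int (Suc n) \<notin> Omega n" by (auto simp: Omega_iff)
  then show "w \<in> hyperoctahedral (Suc n) \<and> w (int (Suc n)) = int (Suc n)"
    using w permutes_subset[of w "Omega n" "Omega (Suc n)"] permutes_not_in[of w "Omega n" "int (Suc n)"]
    by (simp add: hyperoctahedral_iff)
next
  assume w: "w \<in> hyperoctahedral (Suc n) \<and> w (int (Suc n)) = int (Suc n)"
  have "w x = x" if "x \<in> Omega (Suc n) - Omega n" for x
  proof -
    have "x = int (Suc n) \<or> x = - int (Suc n)" using that by (auto simp: Omega_iff)
    then show ?thesis using w hyperoctahedral_minus[of w "Suc n" "int (Suc n)"] by auto
  qed
  then show "w \<in> hyperoctahedral n"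
    using w permutes_superset[of w "Omega (Suc n)" "Omega n"] by (auto simp: hyperoctahedral_iff)
qed

lemma hyperoctahedral_Suc:
  "hyperoctahedral (Suc n) = {u \<circ> signed_swap (int (Suc n)) y | u y.
    u \<in> hyperoctahedral n \<and> y \<in> Omega (Suc n)}" (is "?L = ?R")
proof (intro equalityI subsetI)
  let ?x = "int (Suc n)"
  have x: "?x \<in> Omega (Suc n)" by (simp add: Omega_iff)
  fix w assume w: "w \<in> ?L"
  then have p: "w permutes Omega (Suc n)" by (simp add: hyperoctahedral_iff)
  define y where "y = (inv_into UNIV w) ?x"
  have y: "y \<in> Omega (Suc n)" "w y = ?x"
    unfolding y_def using x permutes_in_image[OF permutes_inv[OF p], of ?x] permutes_inverses(1)[OF p]
    by simp_all
  let ?u = "w \<circ> signed_swap ?x y"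
  have "?u \<in> hyperoctahedral n"
    using hyperoctahedral_Suc_iff[of ?u n] hyperoctahedral_comp[OF w signed_swap_hyperoctahedral[OF x y(1)]] y(2)
    by (simp add: signed_swap_def)
  moreover have "w = ?u \<circ> signed_swap ?x y"
    using signed_swap_invol[OF Omega_nonzero[OF x] Omega_nonzero[OF y(1)]] by (simp add: fun_eq_iff)
  ultimately show "w \<in> ?R" using y(1) by blast
next
  fix w assume "w \<in> ?R"
  then obtain u y where "w = u \<circ> signed_swap (int (Suc n)) y" "u \<in> hyperoctahedral n" "y \<in> Omega (Suc n)"
    by auto
  moreover have "int (Suc n) \<in> Omega (Suc n)" by (simp add: Omega_iff)
  ultimately show "w \<in> ?L"
    using hyperoctahedral_Suc_iff signed_swap_hyperoctahedral hyperoctahedral_comp by metis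
qed

lemma hyperoctahedral_0: "hyperoctahedral 0 = {id}"
  by (auto simp: hyperoctahedral_def Omega_def)

lemma finite_hyperoctahedral [simp]: "finite (hyperoctahedral n)"
  using finite_permutations[of "Omega n"] by (rule rev_finite_subset) (auto simp: hyperoctahedral_def)

lemma hyperoctahedral_subset_comp_list:
  "hyperoctahedral n \<subseteq> comp_list ` lists (signed_swaps n)"
proof (induction n)
  case 0
  then show ?case by (auto simp: hyperoctahedral_0 intro: image_eqI[of _ _ "[]"])
next
  case (Suc n)
  let ?x = "int (Suc n)"
  interpret point_reflections "signed_swaps (Suc n)" ?x "Omega (Suc n)" "signed_swap ?x"
    by (rule point_reflections_signed_swaps) (simp add: Omega_iff)
  show ?case
  proof
    fix p assume "p \<in> hyperoctahedral (Suc n)"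
    then obtain u y where p: "p = u \<circ> signed_swap ?x y" "u \<in> hyperoctahedral n" "y \<in> Omega (Suc n)"
      unfolding hyperoctahedral_Suc by auto
    have "signed_swaps n \<subseteq> signed_swaps (Suc n)"
      using signed_swaps_fixing[of n] by blast
    then have u: "u \<in> comp_list ` lists (signed_swaps (Suc n))"
      using Suc.IH p(2) by (blast dest: comp_list_lists_mono)
    have "signed_swap ?x y \<in> comp_list ` lists (signed_swaps (Suc n))"
    proof (cases "y = ?x")
      case True
      then show ?thesis by (auto simp: signed_swap_self intro: image_eqI[of _ _ "[]"])
    next
      case False
      then show ?thesis using r_in[OF p(3)] by (auto intro: image_eqI[of _ _ "[signed_swap ?x y]"])
    qed
    then show "p \<in> comp_list ` lists (signed_swaps (Suc n))"
      unfolding p(1) using u by (rule comp_list_lists_comp[rotated])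
  qed
qed

text \<open>The step from \<open>n\<close> to \<open>n + 1\<close> has \<open>2 * n + 2\<close>
  possible preimages of the new point, one of them free of cost; hence the odd coefficient.\<close>

lemma length_poly_hyperoctahedral:
  "length_poly (hyperoctahedral n) (comp_length (signed_swaps n)) = (\<Prod>i<n. [:1, 2 * int i + 1:])"
proof (induction n)
  case 0
  then show ?case by (simp add: length_poly_def hyperoctahedral_0)
next
  case (Suc n)
  let ?x = "int (Suc n)"
  interpret point_reflections "signed_swaps (Suc n)" ?x "Omega (Suc n)" "signed_swap ?x"
    by (rule point_reflections_signed_swaps) (simp add: Omega_iff)
  show ?case
    unfolding hyperoctahedral_Suc
    using Suc length_poly_extend[of "hyperoctahedral n"] hyperoctahedral_subset_comp_list
    unfolding signed_swaps_fixing by (simp add: mult.commute add.commute)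
qed

section \<open>Coset representatives\<close>

lemma comp_length_comp_transpose:
  assumes "finite D" "x \<in> D" "y \<in> D" "u permutes D" "u x = x"
  shows "comp_length (transpositions D) (u \<circ> transpose x y) =
    comp_length (transpositions D) u + (if y = x then 0 else 1)"
proof -
  interpret point_reflections "transpositions D" x D "transpose x"
    by (rule point_reflections_transpositions) fact
  have "u permutes D - {x}"
    using assms(4) by (rule permutes_superset) (use assms(5) in auto)
  then have "u \<in> comp_list ` lists T'"
    unfolding transpositions_fixing using permutes_subset_comp_list[of "D - {x}"] assms(1) by blast
  then show ?thesis
    using comp_length_factorization[OF _ assms(3)] comp_length_restrict by simp
qed

text \<open>The mirrored form is needed because representatives and their twists receive new
  transpositions on the left. Since \<open>u\<close> fixes \<open>x\<close>, the transposition
  passes through \<open>u\<close> as \<open>transpose x ?z\<close>.\<close>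

lemma comp_length_transpose_comp:
  assumes "finite D" "x \<in> D" "y \<in> D" "u permutes D" "u x = x"
  shows "comp_length (transpositions D) (transpose x y \<circ> u) =
    comp_length (transpositions D) u + (if y = x then 0 else 1)"
proof -
  let ?z = "inv_into UNIV u y"
  have z: "u ?z = y" "?z \<in> D"
    using permutes_inverses(1)[OF assms(4)] permutes_in_image[OF permutes_inv[OF assms(4)]] assms(3)
    by simp_all
  have "?z = x \<longleftrightarrow> y = x"
    using z(1) assms(5) injD[OF permutes_inj[OF assms(4)]] by metis
  moreover have "transpose x y \<circ> u = u \<circ> transpose x ?z"
    using inj_comp_transpose[OF permutes_inj[OF assms(4)], of x ?z] assms(5) z(1) by simp
  ultimately show ?thesis
    using comp_length_comp_transpose[OF assms(1,2) z(2) assms(4,5)] by simp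
qed

lemma transpositions_invol: "t \<in> transpositions D \<Longrightarrow> t \<circ> t = id"
  by (auto simp: transpositions_def)

text \<open>Up to the factor \<open>uminus\<close>, this is the perfect matching of \<open>Omega n\<close> that corresponds to
  the coset of \<open>p\<close>; twice the length of a coset is the absolute length of this twist.\<close>

definition twist :: "(int \<Rightarrow> int) \<Rightarrow> int \<Rightarrow> int" where
  "twist p = p \<circ> uminus \<circ> inv_into UNIV p \<circ> uminus"

lemma uminus_comp_uminus: "uminus \<circ> uminus = (id :: int \<Rightarrow> int)"
  by (simp add: fun_eq_iff)

lemma bij_betw_uminus_Omega: "bij_betw uminus (Omega n) (Omega n)"
  by (rule bij_betw_byWitness[of _ uminus]) auto

text \<open>A word for \<open>p\<close> is followed by its reversal conjugated letter by letter with
  \<open>uminus\<close>, which maps transpositions of \<open>Omega n\<close> to such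
  transpositions.\<close>

lemma comp_length_twist_le:
  assumes "p permutes Omega n"
  shows "comp_length (transpositions (Omega n)) (twist p) \<le>
    2 * comp_length (transpositions (Omega n)) p"
proof -
  let ?T = "transpositions (Omega n)"
  have "p \<in> comp_list ` lists ?T" using permutes_subset_comp_list[of "Omega n"] assms by auto
  then obtain ts where ts: "ts \<in> lists ?T" "length ts = comp_length ?T p" "comp_list ts = p"
    by (rule comp_length_witness)
  let ?us = "ts @ map (\<lambda>t. uminus \<circ> t \<circ> uminus) (rev ts)"
  have invol: "t \<circ> t = id" if "t \<in> set ts" for t
    using ts(1) that transpositions_invol by (auto simp: in_lists_conv_set)
  then have "comp_list (rev ts) \<circ> p = id"
    using comp_list_rev[of "rev ts"] unfolding rev_rev_ident set_rev ts(3) by blast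
  moreover have "p \<circ> comp_list (rev ts) = id"
    using comp_list_rev[of ts] invol unfolding ts(3) by blast
  ultimately have "inv_into UNIV p = comp_list (rev ts)"
    by (intro inv_unique_comp)
  then have "twist p = comp_list ?us"
    unfolding twist_def comp_list_append comp_list_conj[OF uminus_comp_uminus] ts(3)
    by (simp add: o_assoc)
  moreover have "uminus \<circ> t \<circ> uminus \<in> ?T" if t: "t \<in> ?T" for t
  proof -
    obtain i j where "t = transpose i j" "i \<in> Omega n" "j \<in> Omega n" "i \<noteq> j"
      using t unfolding transpositions_def by blast
    moreover have "uminus \<circ> transpose i j \<circ> uminus = transpose (- i) (- j)"
      unfolding inj_comp_transpose[OF inj_uminus] o_assoc[symmetric] uminus_comp_uminus by simp
    ultimately show ?thesis unfolding transpositions_def using uminus_Omega_iff by fastforce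
  qed
  then have "?us \<in> lists ?T" using ts(1) by auto
  ultimately show ?thesis using comp_length_le[of ?us ?T] ts(2) by simp
qed

text \<open>\<open>h\<close> commutes with \<open>uminus\<close> and meets its own inverse, so the
  twist is an invariant of the left coset.\<close>

lemma twist_comp_hyperoctahedral:
  assumes "bij p" "h \<in> hyperoctahedral n"
  shows "twist (p \<circ> h) = twist p"
proof -
  have h: "bij h" using assms(2) permutes_bij by (auto simp: hyperoctahedral_iff)
  have "inv_into UNIV (p \<circ> h) = inv_into UNIV h \<circ> inv_into UNIV p"
    using o_inv_distrib[OF assms(1) h] .
  moreover have "h \<circ> uminus = uminus \<circ> h"
    using hyperoctahedral_minus[OF assms(2)] by (simp add: fun_eq_iff)
  then have "h \<circ> uminus \<circ> inv_into UNIV h = uminus"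
    using surj_iff[THEN iffD1, OF bij_is_surj[OF h]] by (simp add: o_assoc[symmetric])
  ultimately show ?thesis
    unfolding twist_def by (metis o_assoc)
qed

text \<open>The representative fixes \<open>n + 1\<close> and sends \<open>- (n + 1)\<close> to
  \<open>y\<close>, so \<open>y\<close> is the partner of \<open>n + 1\<close> in the matching of
  the coset. This leaves \<open>2 * n + 1\<close> choices, and \<open>y = - (n + 1)\<close>
  contributes the identity.\<close>

fun coset_reps :: "nat \<Rightarrow> (int \<Rightarrow> int) set" where
  "coset_reps 0 = {id}"
| "coset_reps (Suc n) = {transpose (- int (Suc n)) y \<circ> g | y g.
     y \<in> Omega (Suc n) - {int (Suc n)} \<and> g \<in> coset_reps n}"

lemma permutes_Omega_Suc:
  assumes "g permutes Omega n"
  shows "g permutes Omega (Suc n)" "g (int (Suc n)) = int (Suc n)" "g (- int (Suc n)) = - int (Suc n)"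
proof -
  show "g permutes Omega (Suc n)" using assms by (rule permutes_subset) (auto simp: Omega_iff)
  show "g (int (Suc n)) = int (Suc n)" "g (- int (Suc n)) = - int (Suc n)"
    using permutes_not_in[OF assms] by (simp_all add: Omega_iff)
qed

lemma permutes_Omega_mono: "g permutes Omega n \<Longrightarrow> n \<le> N \<Longrightarrow> g permutes Omega N"
  by (erule permutes_subset) (auto simp: Omega_iff)

lemma coset_reps_permutes: "g \<in> coset_reps n \<Longrightarrow> g permutes Omega n"
proof (induction n arbitrary: g)
  case (Suc n)
  then obtain y g' where g: "g = transpose (- int (Suc n)) y \<circ> g'" "y \<in> Omega (Suc n)" "g' \<in> coset_reps n"
    by auto
  have "- int (Suc n) \<in> Omega (Suc n)" by (simp add: Omega_iff)
  then show ?case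
    unfolding g(1) using permutes_Omega_Suc(1)[OF Suc.IH[OF g(3)]] g(2)
    by (intro permutes_compose permutes_swap_id)
qed simp

text \<open>Lengths refer to the fixed ambient set \<open>Omega N\<close>, so the set of
  transpositions does not change during an induction on \<open>n\<close>.\<close>

lemma comp_length_coset_reps_Suc:
  assumes "Suc n \<le> N" "g \<in> coset_reps n" "y \<in> Omega (Suc n) - {int (Suc n)}"
  shows "comp_length (transpositions (Omega N)) (transpose (- int (Suc n)) y \<circ> g) =
    comp_length (transpositions (Omega N)) g + (if y = - int (Suc n) then 0 else 1)"
  using assms permutes_Omega_mono[OF coset_reps_permutes[OF assms(2)], of N]
    permutes_Omega_Suc(3)[OF coset_reps_permutes[OF assms(2)]]
  by (intro comp_length_transpose_comp) (auto simp: Omega_iff)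

text \<open>A nontrivial transposition in front of \<open>g'\<close> reappears in the twist on both
  sides of \<open>twist g'\<close>, which fixes both new points. By additivity each of the two
  occurrences costs exactly one.\<close>

lemma comp_length_twist_coset_reps:
  "n \<le> N \<Longrightarrow> g \<in> coset_reps n \<Longrightarrow>
    comp_length (transpositions (Omega N)) (twist g) = 2 * comp_length (transpositions (Omega N)) g"
proof (induction n arbitrary: g)
  case 0
  then have "g = id" by simp
  moreover have "twist id = id" by (simp add: twist_def fun_eq_iff)
  ultimately show ?case by (simp only: comp_length_id mult_0_right)
next
  case (Suc n)
  let ?x = "int (Suc n)" and ?T = "transpositions (Omega N)"
  obtain y g' where g: "g = transpose (- ?x) y \<circ> g'" "y \<in> Omega (Suc n)" "y \<noteq> ?x" "g' \<in> coset_reps n"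
    using Suc.prems(2) by auto
  have p: "g' permutes Omega n" using g(4) by (rule coset_reps_permutes)
  have pN: "g' permutes Omega N" using permutes_Omega_mono[OF p] Suc.prems(1) by simp
  note g' = permutes_Omega_Suc(2,3)[OF p]
  have inv_g': "inv_into UNIV g' ?x = ?x" "inv_into UNIV g' (- ?x) = - ?x"
    using g' permutes_inv_eq[OF p] by auto
  have "inv_into UNIV g = inv_into UNIV g' \<circ> transpose (- ?x) y"
    unfolding g(1) by (subst o_inv_distrib) (use permutes_bij[OF p] in simp_all)
  then have "twist g = transpose (- ?x) y \<circ> (g' \<circ> uminus \<circ> inv_into UNIV g') \<circ> (transpose (- ?x) y \<circ> uminus)"
    unfolding twist_def g(1) by (simp only: o_assoc)
  also have "transpose (- ?x) y \<circ> uminus = uminus \<circ> transpose ?x (- y)"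
    unfolding inj_comp_transpose[OF inj_uminus] by simp
  finally have tw: "twist g = transpose (- ?x) y \<circ> (twist g' \<circ> transpose ?x (- y))"
    unfolding twist_def by (simp only: o_assoc)
  have IH: "comp_length ?T (twist g') = 2 * comp_length ?T g'"
    using Suc.IH[OF _ g(4)] Suc.prems(1) by simp
  show ?case
  proof (cases "y = - ?x")
    case True
    then show ?thesis using IH tw g(1) by simp
  next
    case False
    have x: "?x \<in> Omega N" "- ?x \<in> Omega N" "y \<in> Omega N" "- y \<in> Omega N"
      using Suc.prems(1) g(2) by (auto simp: Omega_iff)
    have c: "twist g' permutes Omega N"
    proof -
      have "uminus \<circ> inv_into UNIV g' \<circ> uminus permutes Omega N"
      proof (rule bij_imp_permutes)
        show "bij_betw (uminus \<circ> inv_into UNIV g' \<circ> uminus) (Omega N) (Omega N)"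
          using permutes_imp_bij[OF permutes_inv[OF pN]] bij_betw_uminus_Omega
          by (intro bij_betw_trans)
      next
        fix i assume "i \<notin> Omega N"
        then show "(uminus \<circ> inv_into UNIV g' \<circ> uminus) i = i"
          using permutes_not_in[OF permutes_inv[OF pN], of "- i"] by simp
      qed
      then have "g' \<circ> (uminus \<circ> inv_into UNIV g' \<circ> uminus) permutes Omega N"
        using pN by (rule permutes_compose)
      then show ?thesis unfolding twist_def by (simp only: o_assoc)
    qed
    have fix_c: "twist g' ?x = ?x" "twist g' (- ?x) = - ?x"
      by (simp_all only: twist_def comp_apply inv_g' g' minus_minus)
    have "(twist g' \<circ> transpose ?x (- y)) permutes Omega N"
      using c x by (intro permutes_compose permutes_swap_id)
    \<comment> \<open>Here the exclusion of \<open>y = ?x\<close> is essential: otherwise the right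
      transposition would move \<open>- ?x\<close>, and the left one need not add to the
      length.\<close>
    moreover have "(twist g' \<circ> transpose ?x (- y)) (- ?x) = - ?x"
      using fix_c g(3) by (simp add: transpose_def)
    ultimately have "comp_length ?T (twist g) = comp_length ?T (twist g' \<circ> transpose ?x (- y)) + 1"
      unfolding tw using x False by (subst comp_length_transpose_comp) auto
    also have "comp_length ?T (twist g' \<circ> transpose ?x (- y)) = comp_length ?T (twist g') + 1"
      using x c fix_c False by (subst comp_length_comp_transpose) auto
    finally have "comp_length ?T (twist g) = 2 * (comp_length ?T g' + 1)" using IH by simp
    moreover have "comp_length ?T g = comp_length ?T g' + 1"
      unfolding g(1) using comp_length_coset_reps_Suc[OF Suc.prems(1) g(4), of y] g(2,3) False by simp
    ultimately show ?thesis by simp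
  qed
qed

text \<open>Twice the length of \<open>g\<close> is the length of its twist, which is also the twist
  of \<open>g \<circ> h\<close> and hence at most twice the length of
  \<open>g \<circ> h\<close>.\<close>

lemma comp_length_coset_min:
  assumes "g \<in> coset_reps n" "h \<in> hyperoctahedral n"
  shows "comp_length (transpositions (Omega n)) g \<le> comp_length (transpositions (Omega n)) (g \<circ> h)"
proof -
  have p: "g permutes Omega n" using assms(1) by (rule coset_reps_permutes)
  have "g \<circ> h permutes Omega n"
    using p assms(2) by (auto simp: hyperoctahedral_iff intro: permutes_compose)
  then have "comp_length (transpositions (Omega n)) (twist g) \<le>
      2 * comp_length (transpositions (Omega n)) (g \<circ> h)"
    using comp_length_twist_le[of "g \<circ> h"] twist_comp_hyperoctahedral[OF permutes_bij[OF p] assms(2)]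
    by simp
  then show ?thesis using comp_length_twist_coset_reps[OF order.refl assms(1)] by simp
qed

lemma length_poly_coset_reps:
  "n \<le> N \<Longrightarrow> length_poly (coset_reps n) (comp_length (transpositions (Omega N))) =
    (\<Prod>i<n. [:1, 2 * int i:])"
proof (induction n)
  case 0
  then show ?case by (simp add: length_poly_def)
next
  case (Suc n)
  let ?x = "int (Suc n)" and ?l = "comp_length (transpositions (Omega N))"
  let ?Y = "Omega (Suc n) - {?x}"
  have x: "- ?x \<in> ?Y" by (simp add: Omega_iff)
  have "?x \<in> Omega (Suc n)" by (simp add: Omega_iff)
  then have card: "card ?Y = 2 * n + 1" by simp
  have inj: "inj_on (\<lambda>(y, g). transpose (- ?x) y \<circ> g) (?Y \<times> coset_reps n)"
  proof (rule inj_onI)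
    fix a b assume ab: "a \<in> ?Y \<times> coset_reps n" "b \<in> ?Y \<times> coset_reps n"
      "(\<lambda>(y, g). transpose (- ?x) y \<circ> g) a = (\<lambda>(y, g). transpose (- ?x) y \<circ> g) b"
    obtain y g z h where yz: "a = (y, g)" "b = (z, h)" by (metis surj_pair)
    have eq: "transpose (- ?x) y \<circ> g = transpose (- ?x) z \<circ> h" using ab(3) yz by simp
    have "g (- ?x) = - ?x" "h (- ?x) = - ?x"
      using permutes_Omega_Suc(3) coset_reps_permutes ab(1,2) yz by auto
    then have "y = z" using fun_cong[OF eq, of "- ?x"] by simp
    then have "g = h" using eq by (metis transpose_comp_involutory comp_assoc id_comp)
    with \<open>y = z\<close> show "a = b" using yz by simp
  qed
  have img: "coset_reps (Suc n) = (\<lambda>(y, g). transpose (- ?x) y \<circ> g) ` (?Y \<times> coset_reps n)"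
    by auto
  have "length_poly (coset_reps (Suc n)) ?l =
      (\<Sum>(y, g)\<in>?Y \<times> coset_reps n. monom 1 (?l (transpose (- ?x) y \<circ> g)))"
    unfolding length_poly_def img by (subst sum.reindex[OF inj]) (simp add: case_prod_unfold)
  also have "\<dots> = (\<Sum>(y, g)\<in>?Y \<times> coset_reps n.
      monom 1 (if y = - ?x then 0 else 1) * monom 1 (?l g))"
    using comp_length_coset_reps_Suc[OF Suc.prems]
    by (intro sum.cong) (simp_all add: mult_monom case_prod_unfold mem_Times_iff)
  also have "\<dots> = (\<Sum>y\<in>?Y. monom 1 (if y = - ?x then 0 else 1)) * length_poly (coset_reps n) ?l"
    unfolding length_poly_def sum_product by (simp only: sum.cartesian_product)
  also have "\<dots> = [:1, 2 * int n:] * (\<Prod>i<n. [:1, 2 * int i:])"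
    using sum_monom_indicator[of ?Y "- ?x"] x card Suc by simp
  finally show ?case by (simp add: mult.commute)
qed

text \<open>Both representatives fix \<open>n + 1\<close>, hence so does \<open>h\<close>, and by
  oddness \<open>h\<close> fixes \<open>- (n + 1)\<close>. The values there give equal outer
  transpositions, which are cancelled before descending.\<close>

lemma coset_reps_unique:
  "g \<in> coset_reps n \<Longrightarrow> g' \<in> coset_reps n \<Longrightarrow> h \<in> hyperoctahedral n \<Longrightarrow> g' = g \<circ> h \<Longrightarrow> g' = g"
proof (induction n arbitrary: g g' h)
  case (Suc n)
  let ?x = "int (Suc n)"
  obtain y k where g: "g = transpose (- ?x) y \<circ> k" "y \<in> Omega (Suc n)" "y \<noteq> ?x" "k \<in> coset_reps n"
    using Suc.prems(1) by auto
  obtain z k' where g': "g' = transpose (- ?x) z \<circ> k'" "z \<in> Omega (Suc n)" "z \<noteq> ?x" "k' \<in> coset_reps n"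
    using Suc.prems(2) by auto
  note k = permutes_Omega_Suc(2,3)[OF coset_reps_permutes[OF g(4)]]
  note k' = permutes_Omega_Suc(2,3)[OF coset_reps_permutes[OF g'(4)]]
  have vals: "g ?x = ?x" "g (- ?x) = y" "g' ?x = ?x" "g' (- ?x) = z"
    using k k' g(3) g'(3) by (simp_all add: g(1) g'(1) transpose_def)
  have "inj g" using permutes_inj[OF coset_reps_permutes[OF Suc.prems(1)]] .
  then have hx: "h ?x = ?x"
    using vals Suc.prems(4) by (metis comp_apply injD)
  then have "h (- ?x) = - ?x" using hyperoctahedral_minus[OF Suc.prems(3), of ?x] by simp
  then have yz: "y = z" using vals Suc.prems(4) by simp
  have "transpose (- ?x) y \<circ> k' = transpose (- ?x) y \<circ> (k \<circ> h)"
    using Suc.prems(4) unfolding g(1) g'(1) yz by (simp only: o_assoc)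
  then have "k' = k \<circ> h"
    by (metis transpose_comp_involutory comp_assoc id_comp)
  moreover have "h \<in> hyperoctahedral n"
    using hyperoctahedral_Suc_iff Suc.prems(3) hx by blast
  ultimately have "k' = k" using Suc.IH[OF g(4) g'(4)] by blast
  then show ?case using g(1) g'(1) yz by simp
qed simp

text \<open>A signed swap on the right, which stays in the coset, makes \<open>n + 1\<close> fixed;
  a transposition on the left then makes \<open>- (n + 1)\<close> fixed without moving
  \<open>n + 1\<close>.\<close>

lemma coset_reps_exist:
  "p permutes Omega n \<Longrightarrow> \<exists>g\<in>coset_reps n. \<exists>h\<in>hyperoctahedral n. p = g \<circ> h"
proof (induction n arbitrary: p)
  case 0
  then have "p = id" by (simp add: Omega_def)
  then show ?case by (simp add: hyperoctahedral_0)
next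
  case (Suc n)
  let ?x = "int (Suc n)"
  let ?z = "inv_into UNIV p ?x"
  have x: "?x \<in> Omega (Suc n)" "- ?x \<in> Omega (Suc n)" by (simp_all add: Omega_iff)
  have z: "p ?z = ?x" "?z \<in> Omega (Suc n)"
    using permutes_inverses(1)[OF Suc.prems] permutes_in_image[OF permutes_inv[OF Suc.prems]] x
    by simp_all
  let ?s = "signed_swap ?x ?z"
  have s: "?s \<in> hyperoctahedral (Suc n)" using signed_swap_hyperoctahedral[OF x(1) z(2)] .
  let ?q = "p \<circ> ?s"
  have q: "?q permutes Omega (Suc n)"
    using s Suc.prems by (auto simp: hyperoctahedral_iff intro: permutes_compose)
  have qx: "?q ?x = ?x" using z by (simp add: signed_swap_def)
  let ?y = "?q (- ?x)"
  have "?y \<noteq> ?q ?x" using permutes_inj[OF q] by (metis add_eq_0_iff injD neg_equal_zero of_nat_eq_0_iff nat.distinct(1))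
  then have y: "?y \<in> Omega (Suc n)" "?y \<noteq> ?x"
    using permutes_in_image[OF q] x qx by auto
  let ?r = "transpose (- ?x) ?y \<circ> ?q"
  have r: "?r permutes Omega (Suc n)"
    using q permutes_swap_id[OF x(2) y(1)] by (rule permutes_compose)
  have rx: "?r ?x = ?x" "?r (- ?x) = - ?x" using qx y(2) by (simp_all add: transpose_def)
  have "?r permutes Omega n"
  proof (rule permutes_superset[OF r])
    fix i assume "i \<in> Omega (Suc n) - Omega n"
    then have "i = ?x \<or> i = - ?x" by (auto simp: Omega_iff)
    then show "?r i = i" using rx by auto
  qed
  then obtain g h where gh: "g \<in> coset_reps n" "h \<in> hyperoctahedral n" "?r = g \<circ> h"
    using Suc.IH by blast
  have "h \<in> hyperoctahedral (Suc n)" using gh(2) hyperoctahedral_Suc_iff by blast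
  then have "h \<circ> ?s \<in> hyperoctahedral (Suc n)" using s hyperoctahedral_comp by blast
  moreover have "transpose (- ?x) ?y \<circ> g \<in> coset_reps (Suc n)" using gh(1) y by auto
  moreover have "p = transpose (- ?x) ?y \<circ> g \<circ> (h \<circ> ?s)"
  proof -
    have "?s \<circ> ?s = id"
      using signed_swap_invol[OF Omega_nonzero[OF x(1)] Omega_nonzero[OF z(2)]] by (simp add: fun_eq_iff)
    then have "p = transpose (- ?x) ?y \<circ> ?r \<circ> ?s"
      by (simp add: o_assoc) (simp add: o_assoc[symmetric])
    then show ?thesis unfolding gh(3) by (simp add: o_assoc)
  qed
  ultimately show ?case by blast
qed

section \<open>Reflections, cosets and modularity\<close>

lemma word_prod_sym_Omega: "word_prod (sym_Omega n) = comp_list"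
  by (simp add: fun_eq_iff word_prod_def comp_list_def sym_Omega_def)

lemma word_prod_hyperoctahedral: "word_prod (hyperoctahedral_group n) = comp_list"
  by (simp add: fun_eq_iff word_prod_def comp_list_def hyperoctahedral_group_def)

lemma abs_length_sym_Omega: "abs_length (sym_Omega n) T = comp_length T"
  by (simp add: fun_eq_iff abs_length_def comp_length_def word_prod_sym_Omega)

lemma abs_length_hyperoctahedral: "abs_length (hyperoctahedral_group n) T = comp_length T"
  by (simp add: fun_eq_iff abs_length_def comp_length_def word_prod_hyperoctahedral)

lemma sym_Omega_sel [simp]:
  "carrier (sym_Omega n) = {p. p permutes Omega n}"
  "x \<otimes>\<^bsub>sym_Omega n\<^esub> y = x \<circ> y" "\<one>\<^bsub>sym_Omega n\<^esub> = id"
  by (simp_all add: sym_Omega_def)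

lemma hyperoctahedral_group_sel [simp]:
  "carrier (hyperoctahedral_group n) = hyperoctahedral n"
  "x \<otimes>\<^bsub>hyperoctahedral_group n\<^esub> y = x \<circ> y" "\<one>\<^bsub>hyperoctahedral_group n\<^esub> = id"
  by (simp_all add: hyperoctahedral_group_def)

lemma group_sym_Omega: "group (sym_Omega n)"
proof (rule groupI)
  fix x assume "x \<in> carrier (sym_Omega n)"
  then have "x permutes Omega n" by simp
  then show "\<exists>y\<in>carrier (sym_Omega n). y \<otimes>\<^bsub>sym_Omega n\<^esub> x = \<one>\<^bsub>sym_Omega n\<^esub>"
    using permutes_inv permutes_inv_o(2) by (intro bexI[of _ "inv_into UNIV x"]) auto
qed (auto intro: permutes_compose permutes_id simp del: id_apply simp: o_assoc)

lemma inv_sym_Omega: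
  assumes "p permutes Omega n"
  shows "inv\<^bsub>sym_Omega n\<^esub> p = inv_into UNIV p"
  using assms permutes_inv[OF assms] permutes_inv_o(2)[OF assms]
  by (intro group.inv_equality[OF group_sym_Omega]) simp_all

lemma id_hyperoctahedral: "id \<in> hyperoctahedral n"
  by (simp add: hyperoctahedral_iff permutes_id)

lemma subgroup_hyperoctahedral: "subgroup (hyperoctahedral n) (sym_Omega n)"
proof
  fix x assume x: "x \<in> hyperoctahedral n"
  then have "x permutes Omega n" by (simp add: hyperoctahedral_iff)
  then show "inv\<^bsub>sym_Omega n\<^esub> x \<in> hyperoctahedral n"
    using hyperoctahedral_inv[OF x] inv_sym_Omega by simp
next
  show "\<one>\<^bsub>sym_Omega n\<^esub> \<in> hyperoctahedral n" using id_hyperoctahedral by simp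
next
  fix x y assume "x \<in> hyperoctahedral n" "y \<in> hyperoctahedral n"
  then show "x \<otimes>\<^bsub>sym_Omega n\<^esub> y \<in> hyperoctahedral n" using hyperoctahedral_comp by simp
qed (simp add: hyperoctahedral_def Collect_mono_iff)

lemma hyperoctahedral_group_eq:
  "sym_Omega n\<lparr>carrier := hyperoctahedral n\<rparr> = hyperoctahedral_group n"
  by (simp add: sym_Omega_def hyperoctahedral_group_def)

lemma group_hyperoctahedral: "group (hyperoctahedral_group n)"
  using subgroup.subgroup_is_group[OF subgroup_hyperoctahedral group_sym_Omega]
  unfolding hyperoctahedral_group_eq .

lemma inv_hyperoctahedral:
  assumes "p \<in> hyperoctahedral n"
  shows "inv\<^bsub>hyperoctahedral_group n\<^esub> p = inv_into UNIV p"
  using assms hyperoctahedral_inv[OF assms] permutes_inv_o(2)[of p "Omega n"]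
  by (intro group.inv_equality[OF group_hyperoctahedral]) (simp_all add: hyperoctahedral_iff)

lemma transpose_conj:
  assumes "p permutes D"
  shows "p \<circ> transpose i j \<circ> inv_into UNIV p = transpose (p i) (p j)"
  using inj_comp_transpose[OF permutes_inj[OF assms], of i j] permutes_inv_o(1)[OF assms]
  by (simp only: comp_assoc comp_id)

lemma signed_swap_conj:
  assumes "p \<in> hyperoctahedral n"
  shows "p \<circ> signed_swap i j \<circ> inv_into UNIV p = signed_swap (p i) (p j)"
proof -
  have p: "p permutes Omega n" using assms by (simp add: hyperoctahedral_iff)
  show ?thesis
    using comp_signed_swap[OF permutes_inj[OF p] hyperoctahedral_minus[OF assms], of i j] permutes_inv_o(1)[OF p]
    by (simp only: comp_assoc comp_id)
qed

lemma transpose_minus_one_one: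
  assumes "n \<ge> 1"
  shows "transpose (- 1) 1 \<in> sym_Omega_gens n"
  unfolding sym_Omega_gens_def mem_Collect_eq
  using assms by (intro exI[of _ "- 1"] exI[of _ 1]) (auto simp: Omega_iff)

lemma reflections_sym_Omega:
  assumes "n \<ge> 1"
  shows "reflections (sym_Omega n) (sym_Omega_gens n) = transpositions (Omega n)"
proof (intro equalityI subsetI)
  fix t assume "t \<in> reflections (sym_Omega n) (sym_Omega_gens n)"
  then obtain w i j where w: "w permutes Omega n" "i \<in> Omega n" "j \<in> Omega n" "i < j"
    "t = w \<circ> transpose i j \<circ> inv\<^bsub>sym_Omega n\<^esub> w"
    unfolding reflections_def sym_Omega_gens_def by auto
  then have "t = transpose (w i) (w j)" by (simp only: inv_sym_Omega transpose_conj)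
  moreover have "w i \<noteq> w j" using w(4) permutes_inj[OF w(1)] by (simp add: inj_eq)
  ultimately show "t \<in> transpositions (Omega n)"
    unfolding transpositions_def using w(1-3) permutes_in_image[OF w(1)] by blast
next
  fix t assume "t \<in> transpositions (Omega n)"
  then obtain i j where t: "t = transpose i j" "i \<in> Omega n" "j \<in> Omega n" "i \<noteq> j"
    unfolding transpositions_def by blast
  \<comment> \<open>\<open>?w\<close> is to send -1 to \<open>i\<close> and 1 to \<open>j\<close>.
    After \<open>transpose (- 1) i\<close> the point 1 sits at \<open>?k\<close>; swapping
    \<open>?k\<close> with \<open>j\<close> leaves \<open>i\<close> in place.\<close>
  let ?k = "transpose (- 1) i 1"
  let ?w = "transpose ?k j \<circ> transpose (- 1) i"
  have O: "1 \<in> Omega n" "- 1 \<in> Omega n" using assms by (auto simp: Omega_iff)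
  then have k: "?k \<in> Omega n" "?k \<noteq> i" using t by (auto simp: transpose_def)
  have w: "?w permutes Omega n"
    using permutes_swap_id[OF O(2) t(2)] permutes_swap_id[OF k(1) t(3)] by (rule permutes_compose)
  have "?w (- 1) = i" "?w 1 = j" using k(2) t(4) by simp_all
  then have "t = ?w \<otimes>\<^bsub>sym_Omega n\<^esub> transpose (- 1) 1 \<otimes>\<^bsub>sym_Omega n\<^esub> inv\<^bsub>sym_Omega n\<^esub> ?w"
    unfolding inv_sym_Omega[OF w] sym_Omega_sel transpose_conj[OF w] t(1) by (simp only:)
  then show "t \<in> reflections (sym_Omega n) (sym_Omega_gens n)"
    unfolding reflections_def using w transpose_minus_one_one[OF assms] by (auto simp del: o_apply)
qed

lemma adjacent_signed_swap:
  "i \<ge> 1 \<Longrightarrow> transpose i (i + 1) \<circ> transpose (- i) (- i - 1) = signed_swap i (i + 1)"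
  by (auto simp: fun_eq_iff transpose_def signed_swap_def)

lemma sign_change_signed_swap: "transpose i (- i) = signed_swap i (- i)"
  by (auto simp: fun_eq_iff transpose_def signed_swap_def)

lemma hyperoctahedral_gens_eq:
  "hyperoctahedral_gens n = insert (signed_swap (int n) (- int n))
    {signed_swap i (i + 1) | i. 1 \<le> i \<and> i \<le> int n - 1}"
proof -
  have "{transpose i (i + 1) \<circ> transpose (- i) (- i - 1) | i. 1 \<le> i \<and> i \<le> int n - 1} =
      {signed_swap i (i + 1) | i. 1 \<le> i \<and> i \<le> int n - 1}"
    using adjacent_signed_swap by (auto simp del: o_apply) metis+
  then show ?thesis unfolding hyperoctahedral_gens_def sign_change_signed_swap by (simp only:)
qed

lemma hyperoctahedral_gens_subset:
  assumes "n \<ge> 1"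
  shows "hyperoctahedral_gens n \<subseteq> signed_swaps n"
  unfolding hyperoctahedral_gens_eq using assms
  by (auto intro!: in_signed_swaps simp: Omega_iff)

text \<open>There are two kinds of reflections to reach: the sign changes are conjugate to the
  generator at \<open>n\<close>, all others to \<open>signed_swap 1 2\<close>.\<close>

lemma reflections_hyperoctahedral:
  assumes "n \<ge> 2"
  shows "reflections (hyperoctahedral_group n) (hyperoctahedral_gens n) = signed_swaps n"
proof (intro equalityI subsetI)
  fix t assume "t \<in> reflections (hyperoctahedral_group n) (hyperoctahedral_gens n)"
  then obtain w s where w: "w \<in> hyperoctahedral n" "s \<in> hyperoctahedral_gens n"
    "t = w \<circ> s \<circ> inv\<^bsub>hyperoctahedral_group n\<^esub> w"
    unfolding reflections_def by auto
  then have "s \<in> signed_swaps n" using hyperoctahedral_gens_subset[of n] assms by auto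
  then obtain i j where s: "s = signed_swap i j" "i \<in> Omega n" "j \<in> Omega n" "i \<noteq> j"
    unfolding signed_swaps_def by blast
  have p: "w permutes Omega n" using w(1) by (simp add: hyperoctahedral_iff)
  have "t = signed_swap (w i) (w j)"
    unfolding w(3) inv_hyperoctahedral[OF w(1)] s(1) signed_swap_conj[OF w(1)] ..
  moreover have "w i \<noteq> w j" using s(4) permutes_inj[OF p] by (simp add: inj_eq)
  ultimately show "t \<in> signed_swaps n"
    using s(2,3) permutes_in_image[OF p] in_signed_swaps by simp
next
  fix t assume "t \<in> signed_swaps n"
  then obtain i j where t: "t = signed_swap i j" "i \<in> Omega n" "j \<in> Omega n" "i \<noteq> j"
    unfolding signed_swaps_def by blast
  have "\<exists>w\<in>hyperoctahedral n. \<exists>k l. signed_swap k l \<in> hyperoctahedral_gens n \<and> w k = i \<and> w l = j"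
  proof (cases "j = - i")
    case True
    have n: "int n \<in> Omega n" using assms by (simp add: Omega_iff)
    have w: "signed_swap (int n) i \<in> hyperoctahedral n"
      using signed_swap_hyperoctahedral[OF n t(2)] .
    have "signed_swap (int n) i (int n) = i" by (simp add: signed_swap_def)
    with hyperoctahedral_minus[OF w, of "int n"] True
    have "signed_swap (int n) i (int n) = i" "signed_swap (int n) i (- int n) = j" by simp_all
    moreover have "signed_swap (int n) (- int n) \<in> hyperoctahedral_gens n"
      unfolding hyperoctahedral_gens_eq by simp
    ultimately show ?thesis
      using w by (intro bexI[of _ "signed_swap (int n) i"] exI[of _ "int n"] exI[of _ "- int n"] conjI)
  next
    case False
    have O: "1 \<in> Omega n" "2 \<in> Omega n" using assms by (auto simp: Omega_iff)
    let ?k = "signed_swap 1 i 2"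
    have k: "?k \<in> Omega n" "?k \<noteq> i" "?k \<noteq> - i"
      using t(2) O by (auto simp: signed_swap_def Omega_iff)
    let ?w = "signed_swap ?k j \<circ> signed_swap 1 i"
    have "?w \<in> hyperoctahedral n"
      using signed_swap_hyperoctahedral[OF O(1) t(2)] signed_swap_hyperoctahedral[OF k(1) t(3)]
      by (intro hyperoctahedral_comp)
    moreover have "signed_swap 1 i 1 = i" "signed_swap ?k j i = i" "signed_swap ?k j ?k = j"
      using k(2,3) t(4) False by (auto simp: signed_swap_def)
    then have "?w 1 = i" "?w 2 = j" by simp_all
    moreover note w = calculation
    have "signed_swap 1 2 \<in> hyperoctahedral_gens n"
      unfolding hyperoctahedral_gens_eq using assms by (auto intro!: exI[of _ 1])
    with w show ?thesis by (intro bexI[of _ ?w] exI[of _ 1] exI[of _ 2] conjI)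
  qed
  then obtain w k l where w: "w \<in> hyperoctahedral n" "signed_swap k l \<in> hyperoctahedral_gens n"
    "w k = i" "w l = j" by blast
  then have "t = w \<otimes>\<^bsub>hyperoctahedral_group n\<^esub> signed_swap k l \<otimes>\<^bsub>hyperoctahedral_group n\<^esub>
      inv\<^bsub>hyperoctahedral_group n\<^esub> w"
    unfolding inv_hyperoctahedral[OF w(1)] hyperoctahedral_group_sel signed_swap_conj[OF w(1)] t(1)
    by (simp only:)
  then show "t \<in> reflections (hyperoctahedral_group n) (hyperoctahedral_gens n)"
    unfolding reflections_def using w(1,2) by (auto simp del: o_apply)
qed

section \<open>Left cosets and the factorization of the generating function\<close>

lemma lcoset_sym_Omega: "g <#\<^bsub>sym_Omega n\<^esub> hyperoctahedral n = (\<lambda>h. g \<circ> h) ` hyperoctahedral n"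
  by (auto simp: l_coset_def)

lemma lcoset_self_sym_Omega:
  "g \<in> g <#\<^bsub>sym_Omega n\<^esub> hyperoctahedral n"
  unfolding lcoset_sym_Omega using id_hyperoctahedral by (metis comp_id image_eqI)

lemma bij_betw_coset_reps:
  "bij_betw (\<lambda>g. g <#\<^bsub>sym_Omega n\<^esub> hyperoctahedral n) (coset_reps n) (lcosets\<^bsub>sym_Omega n\<^esub> hyperoctahedral n)"
  unfolding bij_betw_def
proof (intro conjI inj_onI equalityI subsetI)
  fix g g' assume g: "g \<in> coset_reps n" "g' \<in> coset_reps n"
    "g <#\<^bsub>sym_Omega n\<^esub> hyperoctahedral n = g' <#\<^bsub>sym_Omega n\<^esub> hyperoctahedral n"
  then have "g' \<in> g <#\<^bsub>sym_Omega n\<^esub> hyperoctahedral n" using lcoset_self_sym_Omega by blast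
  then obtain h where h: "h \<in> hyperoctahedral n" "g' = g \<circ> h" unfolding lcoset_sym_Omega by blast
  then show "g = g'" using coset_reps_unique[OF g(1,2) h] by simp
next
  fix X assume "X \<in> (\<lambda>g. g <#\<^bsub>sym_Omega n\<^esub> hyperoctahedral n) ` coset_reps n"
  then show "X \<in> lcosets\<^bsub>sym_Omega n\<^esub> hyperoctahedral n"
    unfolding LCOSETS_def using coset_reps_permutes by auto
next
  fix X assume "X \<in> lcosets\<^bsub>sym_Omega n\<^esub> hyperoctahedral n"
  then obtain p where p: "p permutes Omega n" "X = p <#\<^bsub>sym_Omega n\<^esub> hyperoctahedral n"
    unfolding LCOSETS_def by auto
  obtain g h where gh: "g \<in> coset_reps n" "h \<in> hyperoctahedral n" "p = g \<circ> h"
    using coset_reps_exist[OF p(1)] by blast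
  have "p \<in> g <#\<^bsub>sym_Omega n\<^esub> hyperoctahedral n" unfolding lcoset_sym_Omega using gh(2,3) by blast
  then have "g <#\<^bsub>sym_Omega n\<^esub> hyperoctahedral n = X"
    unfolding p(2) using coset_reps_permutes[OF gh(1)] group_sym_Omega subgroup_hyperoctahedral
    by (intro group.l_repr_independence) auto
  then show "X \<in> (\<lambda>g. g <#\<^bsub>sym_Omega n\<^esub> hyperoctahedral n) ` coset_reps n"
    using gh(1) by blast
qed

lemma coset_length_coset_reps:
  assumes "g \<in> coset_reps n"
  shows "coset_length (sym_Omega n) (transpositions (Omega n)) (g <#\<^bsub>sym_Omega n\<^esub> hyperoctahedral n) =
    comp_length (transpositions (Omega n)) g"
  unfolding coset_length_def abs_length_sym_Omega
proof (rule Min_eqI)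
  show "finite (comp_length (transpositions (Omega n)) ` (g <#\<^bsub>sym_Omega n\<^esub> hyperoctahedral n))"
    unfolding lcoset_sym_Omega by simp
  show "comp_length (transpositions (Omega n)) g \<in>
      comp_length (transpositions (Omega n)) ` (g <#\<^bsub>sym_Omega n\<^esub> hyperoctahedral n)"
    using lcoset_self_sym_Omega by blast
next
  fix k assume "k \<in> comp_length (transpositions (Omega n)) ` (g <#\<^bsub>sym_Omega n\<^esub> hyperoctahedral n)"
  then show "comp_length (transpositions (Omega n)) g \<le> k"
    unfolding lcoset_sym_Omega using comp_length_coset_min[OF assms] by auto
qed

lemma length_poly_lcosets:
  "length_poly (lcosets\<^bsub>sym_Omega n\<^esub> hyperoctahedral n) (coset_length (sym_Omega n) (transpositions (Omega n))) =
    (\<Prod>i<n. [:1, 2 * int i:])"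
proof -
  have "length_poly (lcosets\<^bsub>sym_Omega n\<^esub> hyperoctahedral n) (coset_length (sym_Omega n) (transpositions (Omega n))) =
      length_poly (coset_reps n) (comp_length (transpositions (Omega n)))"
    unfolding length_poly_def
    by (subst sum.reindex_bij_betw[OF bij_betw_coset_reps, symmetric]) (simp add: coset_length_coset_reps)
  then show ?thesis using length_poly_coset_reps[of n n] by simp
qed

lemma prod_even_odd:
  "(\<Prod>i<2 * n. [:1, int i:]) = (\<Prod>i<n. [:1, 2 * int i + 1:]) * (\<Prod>i<n. [:1, 2 * int i:])"
proof (induction n)
  case (Suc n)
  have "(\<Prod>i<2 * Suc n. [:1, int i:]) = (\<Prod>i<2 * n. [:1, int i:]) * [:1, 2 * int n:] * [:1, 2 * int n + 1:]"
    by (simp add: add.commute)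
  then show ?case unfolding Suc by (simp only: prod.lessThan_Suc ac_simps)
qed simp

lemma length_poly_factorization:
  "length_poly {p. p permutes Omega n} (comp_length (transpositions (Omega n))) =
    length_poly (hyperoctahedral n) (comp_length (signed_swaps n)) *
    length_poly (lcosets\<^bsub>sym_Omega n\<^esub> hyperoctahedral n)
      (coset_length (sym_Omega n) (transpositions (Omega n)))"
  unfolding length_poly_permutes[OF finite_Omega] length_poly_hyperoctahedral length_poly_lcosets
    card_Omega prod_even_odd ..

text \<open>A transposition has only the identity strictly below it: \<open>y\<close> has length 1
  and \<open>x\<close> at least 1, so the nonnegative length of \<open>y x^-1\<close> must be
  0.\<close>

lemma abs_le_transposition_eq:
  assumes "abs_le (sym_Omega n) (transpositions (Omega n)) x y" "x permutes Omega n" "x \<noteq> id"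
    "y \<in> transpositions (Omega n)" "y \<noteq> id"
  shows "x = y"
proof -
  let ?T = "transpositions (Omega n)"
  have S: "{p. p permutes Omega n} \<subseteq> comp_list ` lists ?T"
    by (rule permutes_subset_comp_list) simp
  have y: "y permutes Omega n"
    using assms(4) by (auto simp: transpositions_def intro: permutes_swap_id)
  let ?z = "y \<circ> inv_into UNIV x"
  have z: "?z permutes Omega n" using permutes_inv[OF assms(2)] y by (rule permutes_compose)
  have "int (comp_length ?T ?z) = int (comp_length ?T y) - int (comp_length ?T x)"
    using assms(1) unfolding abs_le_def abs_length_sym_Omega inv_sym_Omega[OF assms(2)] by simp
  moreover have "comp_length ?T y = 1" using comp_length_member assms(4,5) .
  moreover have "x \<in> comp_list ` lists ?T" using subsetD[OF S] assms(2) by simp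
  then have "comp_length ?T x \<noteq> 0" using comp_length_eq_0[of x ?T] assms(3) by blast
  ultimately have "comp_length ?T ?z = 0" by simp
  moreover have "?z \<in> comp_list ` lists ?T" using subsetD[OF S] z by simp
  ultimately have "?z = id" using comp_length_eq_0[of ?z ?T] by blast
  then have "y \<circ> (inv_into UNIV x \<circ> x) = x" by (simp only: o_assoc id_comp)
  then show ?thesis unfolding permutes_inv_o(2)[OF assms(2)] comp_id ..
qed

lemma not_modular_hyperoctahedral:
  assumes "n \<ge> 2"
  shows "\<not> modular (sym_Omega n) (sym_Omega_gens n) (hyperoctahedral n)"
proof
  assume m: "modular (sym_Omega n) (sym_Omega_gens n) (hyperoctahedral n)"
  let ?s = "transpose 1 2 :: int \<Rightarrow> int" and ?t = "transpose (- 1) (- 2) :: int \<Rightarrow> int"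
  let ?X = "?s <#\<^bsub>sym_Omega n\<^esub> hyperoctahedral n"
  have O: "1 \<in> Omega n" "2 \<in> Omega n" "- 1 \<in> Omega n" "- 2 \<in> Omega n" using assms by (auto simp: Omega_iff)
  have s: "?s permutes Omega n" using permutes_swap_id[OF O(1,2)] .
  have T: "?s \<in> transpositions (Omega n)" "?t \<in> transpositions (Omega n)"
    using O by (simp_all add: in_transpositions)
  have "?X \<in> lcosets\<^bsub>sym_Omega n\<^esub> hyperoctahedral n" unfolding LCOSETS_def using s by auto
  then obtain x where x: "x \<in> ?X" "\<And>y. y \<in> ?X \<Longrightarrow> abs_le (sym_Omega n) (transpositions (Omega n)) x y"
    using m assms unfolding modular_def by (auto simp: reflections_sym_Omega)
  obtain h where h: "h \<in> hyperoctahedral n" "x = ?s \<circ> h" using x(1) unfolding lcoset_sym_Omega by blast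
  have xp: "x permutes Omega n" using h s by (auto simp: hyperoctahedral_iff intro: permutes_compose)
  \<comment> \<open>Otherwise \<open>(1 2)\<close> would belong to the subgroup, but it moves 1 and
    fixes -1.\<close>
  have "x \<noteq> id"
  proof
    assume "x = id"
    then have sh: "?s (h k) = k" for k using fun_cong[OF h(2), of k] by simp
    then have "h k = ?s k" for k using sh[of k] transpose_involutory by metis
    then show False using hyperoctahedral_minus[OF h(1), of 1] by simp
  qed
  have "?t \<in> ?X"
  proof -
    have "signed_swap 1 2 \<in> hyperoctahedral n" using signed_swap_hyperoctahedral[OF O(1,2)] .
    moreover have "?t = ?s \<circ> signed_swap 1 2"
      by (auto simp: fun_eq_iff transpose_def signed_swap_def)
    ultimately show ?thesis unfolding lcoset_sym_Omega by blast
  qed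
  moreover have "?s \<in> ?X" by (rule lcoset_self_sym_Omega)
  moreover have "?s \<noteq> id" "?t \<noteq> id" by (auto simp: fun_eq_iff transpose_def)
  ultimately have "x = ?s" "x = ?t"
    using abs_le_transposition_eq[OF x(2) xp \<open>x \<noteq> id\<close>] T by blast+
  then have "?s 1 = ?t 1" by simp
  then show False by simp
qed

section \<open>Coxeter systems whose graph is a path\<close>

lemma coxeter_eq_lists: "coxeter_eq S m u v \<Longrightarrow> u \<in> lists S \<and> v \<in> lists S"
proof (induction rule: coxeter_eq.induct)
  case (rel s t k u v)
  have "set (concat (replicate k [s, t])) \<subseteq> {s, t}" by (induction k) auto
  then show ?case using rel by (auto simp: in_lists_conv_set)
qed auto

lemma coxeter_eq_context:
  "coxeter_eq S m u v \<Longrightarrow> x \<in> lists S \<Longrightarrow> y \<in> lists S \<Longrightarrow> coxeter_eq S m (x @ u @ y) (x @ v @ y)"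
proof (induction rule: coxeter_eq.induct)
  case (refl u)
  then show ?case by (intro coxeter_eq.refl) simp
next
  case (sym u v)
  then show ?case by (auto intro: coxeter_eq.sym)
next
  case (trans u v w)
  then show ?case by (auto intro: coxeter_eq.trans)
next
  case (rel s t k u v)
  then show ?case using coxeter_eq.rel[of s S t m k "x @ u" "v @ y"] by simp
qed

lemma coxeter_eq_append:
  assumes "coxeter_eq S m u u'" "coxeter_eq S m v v'"
  shows "coxeter_eq S m (u @ v) (u' @ v')"
  using coxeter_eq_context[OF assms(1), of "[]" v] coxeter_eq_context[OF assms(2), of u' "[]"]
    coxeter_eq_lists[OF assms(1)] coxeter_eq_lists[OF assms(2)] by (auto intro: coxeter_eq.trans)

lemma coxeter_eq_relator:
  "s \<in> S \<Longrightarrow> t \<in> S \<Longrightarrow> m s t = enat k \<Longrightarrow> coxeter_eq S m (concat (replicate k [s, t])) []"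
  using coxeter_eq.rel[of s S t m k "[]" "[]"] by simp

lemma coxeter_eq_rev:
  assumes "\<And>s. s \<in> S \<Longrightarrow> m s s = 1"
  shows "r \<in> lists S \<Longrightarrow> coxeter_eq S m (rev r @ r) []"
proof (induction r)
  case Nil
  show ?case by (simp add: coxeter_eq.refl)
next
  case (Cons s r)
  then have "coxeter_eq S m [s, s] []"
    using coxeter_eq_relator[of s S s m 1] assms by (simp add: one_enat_def)
  then have "coxeter_eq S m (rev r @ [s, s] @ r) (rev r @ [] @ r)"
    using Cons.prems by (intro coxeter_eq_context) auto
  then show ?case using Cons by (auto intro: coxeter_eq.trans)
qed

text \<open>Words have no formal inverses; reversal takes their place because every generator
  squares to the empty word.\<close>

lemma coxeter_eq_from_relator:
  assumes "\<And>s. s \<in> S \<Longrightarrow> m s s = 1" "coxeter_eq S m (l @ rev r) []"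
  shows "coxeter_eq S m l r"
proof -
  have lr: "l \<in> lists S" "r \<in> lists S" using coxeter_eq_lists[OF assms(2)] by auto
  have "coxeter_eq S m (l @ rev r @ r) (l @ [])"
    using coxeter_eq_append[OF coxeter_eq.refl[OF lr(1)] coxeter_eq_rev[OF assms(1) lr(2)]] .
  moreover have "coxeter_eq S m ((l @ rev r) @ r) ([] @ r)"
    using coxeter_eq_append[OF assms(2) coxeter_eq.refl[OF lr(2)]] .
  ultimately show ?thesis by (auto intro: coxeter_eq.trans coxeter_eq.sym)
qed

text \<open>For generators of the two path graphs this is the order of \<open>s \<circ> t\<close>,
  read off from the shortest relation that holds; the default 4 is justified by
  \<open>relations_S\<close>. Being a function of the generators themselves, it requires no recovery
  of indices.\<close>

definition small_order :: "('a \<Rightarrow> 'a) \<Rightarrow> ('a \<Rightarrow> 'a) \<Rightarrow> enat" where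
  "small_order s t = (if s = t then 1 else if s \<circ> t = t \<circ> s then 2
     else if s \<circ> t \<circ> s = t \<circ> s \<circ> t then 3 else 4)"

lemma coxeter_matrix_small_order: "coxeter_matrix S small_order"
proof -
  have "(2::enat) \<le> 3" "(2::enat) \<le> 4"
    unfolding numeral_eq_enat enat_ord_simps by simp_all
  then show ?thesis unfolding coxeter_matrix_def small_order_def by auto
qed

text \<open>The letters \<open>k, k - 1, ..., j\<close>; the value \<open>j = k + 1\<close> supplies
  the empty word.\<close>

abbreviation down :: "nat \<Rightarrow> nat \<Rightarrow> nat list" where
  "down k j \<equiv> rev [j..<Suc k]"

lemma down_snoc: "j \<le> k \<Longrightarrow> down k j = down k (Suc j) @ [j]"
  by (simp add: upt_rec)

lemma down_split: "j \<le> Suc i \<Longrightarrow> i \<le> k \<Longrightarrow> down k j = down k (Suc i) @ down i j"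
  using upt_add_eq_append[of j "Suc i" "k - i"] by simp

text \<open>These \<open>2 * k\<close> words represent the right cosets of the rank
  \<open>k - 1\<close> subgroup in rank \<open>k\<close>: descents that stop above 1 (empty for
  \<open>j = k\<close>), and full descents to 1 followed by an ascent to \<open>j\<close> (no ascent
  for \<open>j = 1\<close>).\<close>

definition signed_suffixes :: "nat \<Rightarrow> nat list set" where
  "signed_suffixes k = {down k (j + 1) | j. 1 \<le> j \<and> j \<le> k} \<union>
     {down k 1 @ [2..<Suc j] | j. 1 \<le> j \<and> j \<le> k}"

lemma signed_suffixes_down: "1 \<le> j \<Longrightarrow> j \<le> k + 1 \<Longrightarrow> 1 \<le> k \<Longrightarrow> down k j \<in> signed_suffixes k"
proof (cases "j = 1")
  case True
  assume "1 \<le> k"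
  then have "down k 1 @ [2..<Suc 1] \<in> signed_suffixes k" unfolding signed_suffixes_def by blast
  then show ?thesis using True by simp
next
  case False
  assume "1 \<le> j" "j \<le> k + 1"
  then show ?thesis
    unfolding signed_suffixes_def using False by (intro UnI1 CollectI exI[of _ "j - 1"]) auto
qed

lemma signed_suffixes_up: "1 \<le> j \<Longrightarrow> j \<le> k \<Longrightarrow> down k 1 @ [2..<Suc j] \<in> signed_suffixes k"
  unfolding signed_suffixes_def by blast

text \<open>Generators \<open>a 1, \<dots>, a N\<close> whose Coxeter graph is a path: the edges between \<open>i\<close> and \<open>i + 1\<close>
  are unlabelled for \<open>b \<le> i\<close> and labelled 4 for \<open>i < b\<close>. So \<open>b = 1\<close> is type A and \<open>b = 2\<close> is type B.\<close>

locale coxeter_path =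
  fixes a :: "nat \<Rightarrow> 'x \<Rightarrow> 'x" and N b :: nat
  assumes b_pos: "1 \<le> b"
    and invol: "1 \<le> i \<Longrightarrow> i \<le> N \<Longrightarrow> a i \<circ> a i = id"
    and commute: "1 \<le> i \<Longrightarrow> i + 2 \<le> j \<Longrightarrow> j \<le> N \<Longrightarrow> a i \<circ> a j = a j \<circ> a i"
    and braid: "b \<le> i \<Longrightarrow> i < N \<Longrightarrow> a i \<circ> a (i + 1) \<circ> a i = a (i + 1) \<circ> a i \<circ> a (i + 1)"
    and square: "1 \<le> i \<Longrightarrow> i < b \<Longrightarrow> i < N \<Longrightarrow>
      a i \<circ> a (i + 1) \<circ> a i \<circ> a (i + 1) = a (i + 1) \<circ> a i \<circ> a (i + 1) \<circ> a i"
begin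

section \<open>Relations between two generators and their consequences for words\<close>

abbreviation "S \<equiv> a ` {1..N}"
abbreviation "ceq \<equiv> coxeter_eq S small_order"

lemma invol_S: "s \<in> S \<Longrightarrow> s \<circ> s = id"
  using invol by auto

lemma relations_S:
  assumes "s \<in> S" "t \<in> S"
  shows "s \<circ> t = t \<circ> s \<or> s \<circ> t \<circ> s = t \<circ> s \<circ> t \<or> s \<circ> t \<circ> s \<circ> t = t \<circ> s \<circ> t \<circ> s"
proof -
  have "a i \<circ> a j = a j \<circ> a i \<or> a i \<circ> a j \<circ> a i = a j \<circ> a i \<circ> a j \<or>
      a i \<circ> a j \<circ> a i \<circ> a j = a j \<circ> a i \<circ> a j \<circ> a i" if "i \<le> j" "1 \<le> i" "j \<le> N" for i j
  proof -
    have "i = j \<or> (j = i + 1 \<and> b \<le> i) \<or> (j = i + 1 \<and> i < b) \<or> i + 2 \<le> j"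
      using that(1) by arith
    then consider "i = j" | "j = i + 1" "b \<le> i" | "j = i + 1" "i < b" | "i + 2 \<le> j" by blast
    then show ?thesis
    proof cases
      case 1
      then show ?thesis by simp
    next
      case 2
      have "i < N" using 2(1) that(3) by simp
      then show ?thesis using braid[OF 2(2)] unfolding 2(1) by blast
    next
      case 3
      have "i < N" using 3(1) that(3) by simp
      then show ?thesis using square[OF that(2) 3(2)] unfolding 3(1) by blast
    next
      case 4
      then show ?thesis using commute[OF that(2) 4 that(3)] by blast
    qed
  qed
  moreover obtain i j where "s = a i" "t = a j" "1 \<le> i" "1 \<le> j" "i \<le> N" "j \<le> N"
    using assms by auto
  ultimately show ?thesis by (metis linear)
qed

text \<open>An equation between two alternating words, one followed by the reversal of the other, is
  exactly the alternating word of \<open>k\<close> pairs.\<close>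

lemma small_order_relator:
  assumes "s \<in> S" "t \<in> S" "small_order s t = enat k"
  shows "comp_list (concat (replicate k [s, t])) = id"
proof -
  have rel: "comp_list (l @ rev r) = id"
    if "comp_list l = comp_list r" "set r \<subseteq> {s, t}" for l r
    unfolding comp_list_append that(1) using that(2) assms(1,2) invol_S by (intro comp_list_rev) blast
  note rel = rel[of "[s]" "[s]"] rel[of "[s, t]" "[t, s]"] rel[of "[s, t, s]" "[t, s, t]"]
    rel[of "[s, t, s, t]" "[t, s, t, s]"]
  consider "s = t" "k = 1" | "s \<circ> t = t \<circ> s" "k = 2" | "s \<circ> t \<circ> s = t \<circ> s \<circ> t" "k = 3"
    | "s \<circ> t \<circ> s \<circ> t = t \<circ> s \<circ> t \<circ> s" "k = 4"
    using assms(3) relations_S[OF assms(1,2)] unfolding small_order_def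
    by (auto simp: one_enat_def numeral_eq_enat split: if_splits)
  then show ?thesis
    by cases (use rel in \<open>simp_all add: numeral_eq_Suc o_assoc del: o_apply\<close>)
qed

lemma ceq_sound: "ceq u v \<Longrightarrow> comp_list u = comp_list v"
proof (induction rule: coxeter_eq.induct)
  case (rel s t k u v)
  then show ?case by (simp only: comp_list_append small_order_relator id_comp)
qed simp_all

lemma small_order_self: "small_order s s = 1"
  by (simp add: small_order_def)

lemma ceq_from_relator: "ceq (l @ rev r) [] \<Longrightarrow> ceq l r"
  by (rule coxeter_eq_from_relator) (simp_all add: small_order_self)

lemma ceq_commute:
  assumes "s \<in> S" "t \<in> S" "s \<circ> t = t \<circ> s"
  shows "ceq [s, t] [t, s]"
proof (cases "s = t")
  case True
  then show ?thesis using assms by (auto intro: coxeter_eq.refl)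
next
  case False
  then have "small_order s t = enat 2" using assms(3) by (simp add: small_order_def numeral_eq_enat)
  then have "ceq (concat (replicate 2 [s, t])) []" by (rule coxeter_eq_relator[OF assms(1,2)])
  then show ?thesis
    using ceq_from_relator[of "[s, t]" "[t, s]"] by (simp add: numeral_eq_Suc)
qed

text \<open>The relator is available only if \<open>small_order s t\<close> is really 3. Commuting
  involutions with a braid relation would coincide, and equal generators are treated apart.\<close>

lemma ceq_braid:
  assumes "s \<in> S" "t \<in> S" "s \<circ> t \<circ> s = t \<circ> s \<circ> t"
  shows "ceq [s, t, s] [t, s, t]"
proof (cases "s = t")
  case True
  then show ?thesis using assms by (auto intro: coxeter_eq.refl)
next
  case False
  have ss: "s (s x) = x" and tt: "t (t x) = x" for x
    using fun_cong[OF invol_S[OF assms(1)], of x] fun_cong[OF invol_S[OF assms(2)], of x] by simp_all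
  have "s \<circ> t \<noteq> t \<circ> s"
  proof
    assume "s \<circ> t = t \<circ> s"
    then have c: "s (t x) = t (s x)" for x by (simp add: fun_eq_iff)
    have "s x = t x" for x
      using fun_cong[OF assms(3), of x] by (simp add: c ss tt)
    then have "s = t" by (rule ext)
    with False show False ..
  qed
  then have "small_order s t = enat 3"
    using assms(3) False by (simp add: small_order_def numeral_eq_enat del: o_apply)
  then have "ceq (concat (replicate 3 [s, t])) []" by (rule coxeter_eq_relator[OF assms(1,2)])
  then show ?thesis
    using ceq_from_relator[of "[s, t, s]" "[t, s, t]"] by (simp add: numeral_eq_Suc)
qed

text \<open>If \<open>s\<close> and \<open>t\<close> commute, commutation applied twice suffices.
  Otherwise the order is 4, because a braid relation together with the given equation would again
  force commutation.\<close>

lemma ceq_square: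
  assumes "s \<in> S" "t \<in> S" "s \<circ> t \<circ> s \<circ> t = t \<circ> s \<circ> t \<circ> s"
  shows "ceq [s, t, s, t] [t, s, t, s]"
proof (cases "s \<circ> t = t \<circ> s")
  case True
  then show ?thesis
    using coxeter_eq_append[OF ceq_commute ceq_commute, of s t s t] assms(1,2) by simp
next
  case False
  have ss: "s (s x) = x" and tt: "t (t x) = x" for x
    using fun_cong[OF invol_S[OF assms(1)], of x] fun_cong[OF invol_S[OF assms(2)], of x] by simp_all
  have "s \<circ> t \<circ> s \<noteq> t \<circ> s \<circ> t"
  proof
    assume sts: "s \<circ> t \<circ> s = t \<circ> s \<circ> t"
    then have b: "s (t (s x)) = t (s (t x))" for x by (simp add: fun_eq_iff)
    have "s (t x) = t (s x)" for x
    proof -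
      have "t (s x) = s (t (s (t x)))" by (simp add: b tt)
      also have "\<dots> = t (s (t (s x)))" using fun_cong[OF assms(3), of x] by simp
      also have "\<dots> = s (t x)" by (simp add: b[symmetric] ss)
      finally show ?thesis ..
    qed
    then have "s \<circ> t = t \<circ> s" by (simp add: fun_eq_iff)
    with False show False ..
  qed
  moreover have "s \<noteq> t" using False by auto
  ultimately have "small_order s t = enat 4"
    using False by (simp add: small_order_def numeral_eq_enat del: o_apply)
  then have "ceq (concat (replicate 4 [s, t])) []" by (rule coxeter_eq_relator[OF assms(1,2)])
  then show ?thesis
    using ceq_from_relator[of "[s, t, s, t]" "[t, s, t, s]"] by (simp add: numeral_eq_Suc)
qed

text \<open>Equality of words of indices. Words with an index outside \<open>{1..N}\<close> are equal to each other
  by convention, so that most relations need no range conditions.\<close>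

definition weq :: "nat list \<Rightarrow> nat list \<Rightarrow> bool" (infix "\<approx>" 50) where
  "u \<approx> v \<longleftrightarrow> (u \<in> lists {1..N} \<longleftrightarrow> v \<in> lists {1..N}) \<and>
     (u \<in> lists {1..N} \<longrightarrow> ceq (map a u) (map a v))"

section \<open>Moving letters through suffixes of index words\<close>

lemma map_S: "u \<in> lists {1..N} \<Longrightarrow> map a u \<in> lists S"
  by auto

lemma weq_refl [simp]: "u \<approx> u"
  unfolding weq_def using coxeter_eq.refl[OF map_S] by simp

lemma weq_sym: "u \<approx> v \<Longrightarrow> v \<approx> u"
  unfolding weq_def using coxeter_eq.sym by blast

lemma weq_trans [trans]: "u \<approx> v \<Longrightarrow> v \<approx> w \<Longrightarrow> u \<approx> w"
  unfolding weq_def using coxeter_eq.trans by blast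

lemma weq_append: "u \<approx> u' \<Longrightarrow> v \<approx> v' \<Longrightarrow> u @ v \<approx> u' @ v'"
  unfolding weq_def map_append append_in_lists_conv using coxeter_eq_append by blast

lemma weq_context: "u \<approx> v \<Longrightarrow> x @ u @ y \<approx> x @ v @ y"
  by (intro weq_append weq_refl)

lemma weq_cancel: "1 \<le> i \<Longrightarrow> i \<le> N \<Longrightarrow> [i, i] \<approx> []"
  unfolding weq_def
  using coxeter_eq_relator[of "a i" S "a i" small_order 1] by (simp add: small_order_self one_enat_def)

lemma weq_commute:
  assumes "i + 2 \<le> j \<or> j + 2 \<le> i"
  shows "[i, j] \<approx> [j, i]"
proof -
  have "ceq [a i, a j] [a j, a i]" if "1 \<le> i" "1 \<le> j" "i \<le> N" "j \<le> N"
    using assms that commute[of i j] commute[of j i] by (intro ceq_commute) auto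
  then show ?thesis by (auto simp: weq_def)
qed

lemma weq_braid:
  assumes "b \<le> i"
  shows "[i, i + 1, i] \<approx> [i + 1, i, i + 1]"
proof -
  have "ceq [a i, a (i + 1), a i] [a (i + 1), a i, a (i + 1)]" if "i + 1 \<le> N"
    using assms that braid[of i] b_pos by (intro ceq_braid) auto
  then show ?thesis by (auto simp: weq_def)
qed

lemma weq_square:
  assumes "i < b"
  shows "[i, i + 1, i, i + 1] \<approx> [i + 1, i, i + 1, i]"
proof -
  have "ceq [a i, a (i + 1), a i, a (i + 1)] [a (i + 1), a i, a (i + 1), a i]" if "1 \<le> i" "i + 1 \<le> N"
    using assms that square[of i] by (intro ceq_square) auto
  then show ?thesis by (auto simp: weq_def)
qed

lemma weq_commute_word:
  "(\<And>l. l \<in> set w \<Longrightarrow> i + 2 \<le> l \<or> l + 2 \<le> i) \<Longrightarrow> w @ [i] \<approx> [i] @ w"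
proof (induction w)
  case (Cons l w)
  have "(l # w) @ [i] \<approx> [l] @ [i] @ w"
    using weq_append[OF weq_refl[of "[l]"] Cons.IH] Cons.prems by simp
  also have "\<dots> \<approx> [i] @ [l] @ w"
    using weq_append[OF weq_commute[of l i] weq_refl[of w]] Cons.prems[of l] by auto
  finally show ?case by simp
qed simp

text \<open>The letter passes the low part by commutation, one braid relation turns
  \<open>i + 1, i, i + 1\<close> into \<open>i, i + 1, i\<close>, and the leading \<open>i\<close>
  commutes with the high part. The letter thus leaves on the left lowered by one.\<close>

lemma weq_down_shift:
  assumes "b \<le> i" "j \<le> i" "i < k"
  shows "down k j @ [i + 1] \<approx> [i] @ down k j"
proof -
  let ?x = "down k (i + 2)" and ?y = "down (i - 1) j"
  have i: "i \<ge> 1" using assms b_pos by simp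
  have "down (i + 1) j = [i + 1, i] @ ?y"
    using assms i by (cases i) auto
  then have eq: "down k j = ?x @ [i + 1, i] @ ?y" using down_split[of j "i + 1" k] assms by simp
  have "down k j @ [i + 1] \<approx> ?x @ [i + 1, i] @ [i + 1] @ ?y"
    unfolding eq append_assoc using assms i by (intro weq_append weq_refl weq_commute_word) auto
  also have "\<dots> = ?x @ [i + 1, i, i + 1] @ ?y" by simp
  also have "\<dots> \<approx> ?x @ [i, i + 1, i] @ ?y"
    by (intro weq_context weq_sym[OF weq_braid] assms)
  also have "\<dots> = (?x @ [i]) @ [i + 1, i] @ ?y" by simp
  also have "\<dots> \<approx> ([i] @ ?x) @ [i + 1, i] @ ?y"
    by (intro weq_append weq_refl weq_commute_word) auto
  finally show ?thesis unfolding eq by simp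
qed

text \<open>Mirror image of \<open>weq_down_shift\<close>: an ascent raises the letter by
  one.\<close>

lemma weq_up_shift:
  assumes "b \<le> i" "c \<le> i" "i < j"
  shows "[c..<Suc j] @ [i] \<approx> [i + 1] @ [c..<Suc j]"
proof -
  let ?x = "[c..<i]" and ?y = "[i + 2..<Suc j]"
  have i: "i \<ge> 1" using assms b_pos by simp
  have "[i..<Suc j] = [i, i + 1] @ ?y" using assms by (simp add: upt_rec)
  then have eq: "[c..<Suc j] = ?x @ [i, i + 1] @ ?y"
    using upt_add_eq_append[of c i "Suc j - i"] assms by simp
  have "[c..<Suc j] @ [i] \<approx> ?x @ [i, i + 1] @ [i] @ ?y"
    unfolding eq append_assoc by (intro weq_append weq_refl weq_commute_word) auto
  also have "\<dots> = ?x @ [i, i + 1, i] @ ?y" by simp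
  also have "\<dots> \<approx> ?x @ [i + 1, i, i + 1] @ ?y"
    by (intro weq_context weq_braid assms)
  also have "\<dots> = (?x @ [i + 1]) @ [i, i + 1] @ ?y" by simp
  also have "\<dots> \<approx> ([i + 1] @ ?x) @ [i, i + 1] @ ?y"
    using i by (intro weq_append weq_refl weq_commute_word) auto
  finally show ?thesis unfolding eq by simp
qed

lemma weq_snoc_cancel: "1 \<le> i \<Longrightarrow> i \<le> N \<Longrightarrow> w @ [i] @ [i] \<approx> w"
  using weq_append[OF weq_refl[of w] weq_cancel[of i]] by simp

text \<open>The alternatives are a change of coset and a letter that passes to the left. The last
  assumption keeps the braid relation at \<open>i - 1\<close> away from the edges labelled
  4.\<close>

lemma weq_down_step:
  assumes "1 \<le> i" "i \<le> k" "k \<le> N" "1 \<le> j" "j \<le> k + 1" "j < i \<Longrightarrow> b < i"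
  shows "(\<exists>j'. 1 \<le> j' \<and> j' \<le> k + 1 \<and> down k j @ [i] \<approx> down k j') \<or>
    (\<exists>l. 1 \<le> l \<and> l < k \<and> down k j @ [i] \<approx> [l] @ down k j)"
proof -
  consider "i + 1 < j" | "j = i + 1" | "j = i" | "j < i" by linarith
  then show ?thesis
  proof cases
    case 1
    then have "down k j @ [i] \<approx> [i] @ down k j" by (intro weq_commute_word) auto
    then show ?thesis using 1 assms by (intro disjI2 exI[of _ i]) auto
  next
    case 2
    then have "down k j @ [i] = down k i" using down_snoc[of i k] assms by simp
    then have "down k j @ [i] \<approx> down k i" by simp
    then show ?thesis using assms by (intro disjI1 exI[of _ i]) auto
  next
    case 3
    then have "down k j @ [i] \<approx> down k (Suc j)"
      using down_snoc[of j k] weq_snoc_cancel[of i "down k (Suc j)"] assms by simp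
    then show ?thesis using 3 assms by (intro disjI1 exI[of _ "Suc j"]) auto
  next
    case 4
    then have "down k j @ [i] \<approx> [i - 1] @ down k j"
      using weq_down_shift[of "i - 1" j k] assms by simp
    then show ?thesis using 4 assms by (intro disjI2 exI[of _ "i - 1"]) auto
  qed
qed

lemma val_rev: "u \<in> lists {1..N} \<Longrightarrow> comp_list (map a u) \<circ> comp_list (map a (rev u)) = id"
  unfolding rev_map[symmetric] using invol_S by (intro comp_list_rev) auto

lemma val_rev': "u \<in> lists {1..N} \<Longrightarrow> comp_list (map a (rev u)) \<circ> comp_list (map a u) = id"
  using val_rev[of "rev u"] by (simp add: in_lists_conv_set)

lemma val_rev_apply:
  "u \<in> lists {1..N} \<Longrightarrow> comp_list (map a u) y = z \<Longrightarrow> comp_list (map a (rev u)) z = y"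
  using fun_cong[OF val_rev', of u y] by simp

lemma down_suffixes_step:
  assumes "b = 1" and k: "1 \<le> i" "i \<le> k" "k \<le> N" and r: "r \<in> {down k j | j. 1 \<le> j \<and> j \<le> k + 1}"
  shows "\<exists>r'\<in>{down k j | j. 1 \<le> j \<and> j \<le> k + 1}.
    r @ [i] \<approx> r' \<or> (\<exists>l. 1 \<le> l \<and> l < k \<and> r @ [i] \<approx> [l] @ r')"
proof -
  obtain j where j: "r = down k j" "1 \<le> j" "j \<le> k + 1" using r by blast
  have "(\<exists>j'. 1 \<le> j' \<and> j' \<le> k + 1 \<and> r @ [i] \<approx> down k j') \<or>
      (\<exists>l. 1 \<le> l \<and> l < k \<and> r @ [i] \<approx> [l] @ r)"
    unfolding j(1) using k j(2,3) assms(1) by (intro weq_down_step) auto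
  then show ?thesis using r by blast
qed

text \<open>Pure descents stop above 1, so only unlabelled edges are crossed. In a descent with
  ascent, the letter may cancel or extend the end of the ascent, pass through both parts, or, if it
  is 1 and an ascent exists, meet the turn \<open>2, 1, 2\<close>.\<close>

lemma signed_suffixes_step:
  assumes b: "b = 2" and k: "1 \<le> i" "i \<le> k" "k \<le> N" and r: "r \<in> signed_suffixes k"
  shows "\<exists>r'\<in>signed_suffixes k. r @ [i] \<approx> r' \<or> (\<exists>l. 1 \<le> l \<and> l < k \<and> r @ [i] \<approx> [l] @ r')"
proof -
  have k1: "1 \<le> k" using k by simp
  from r consider j where "r = down k (j + 1)" "1 \<le> j" "j \<le> k"
    | j where "r = down k 1 @ [2..<Suc j]" "1 \<le> j" "j \<le> k"
    unfolding signed_suffixes_def by blast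
  then show ?thesis
  proof cases
    case (1 j)
    have "(\<exists>j'. 1 \<le> j' \<and> j' \<le> k + 1 \<and> r @ [i] \<approx> down k j') \<or>
        (\<exists>l. 1 \<le> l \<and> l < k \<and> r @ [i] \<approx> [l] @ r)"
      using weq_down_step[OF k, of "j + 1"] 1 b by (simp del: upt_Suc)
    then show ?thesis using signed_suffixes_down k1 r by blast
  next
    case (2 j)
    let ?u = "[2..<Suc j]"
    consider "i = 1" "j = 1" | "i = j" "2 \<le> j" | "i = j + 1" | "j + 2 \<le> i" | "2 \<le> i" "i < j" | "i = 1" "2 \<le> j"
      using k(1) 2(2) by linarith
    then show ?thesis
    proof cases
      case 1
      have "down k 1 = down k 2 @ [1]" using down_snoc[OF k1] by (simp add: numeral_2_eq_2 del: upt_Suc)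
      then have "r @ [i] = down k 2 @ [1] @ [1]" using 1 2(1) by simp
      then have "r @ [i] \<approx> down k 2" using weq_snoc_cancel[of 1] k by simp
      then show ?thesis using signed_suffixes_down[of 2 k] k1 by auto
    next
      case 2
      have "?u = [2..<j] @ [j]" using \<open>2 \<le> j\<close> by simp
      then have "r @ [i] = (down k 1 @ [2..<j]) @ [j] @ [j]"
        using \<open>r = _\<close> \<open>i = j\<close> by simp
      then have "r @ [i] \<approx> down k 1 @ [2..<Suc (j - 1)]"
        using weq_snoc_cancel[of j "down k 1 @ [2..<j]"] \<open>2 \<le> j\<close> \<open>j \<le> k\<close> k by simp
      then show ?thesis using signed_suffixes_up[of "j - 1" k] \<open>2 \<le> j\<close> \<open>j \<le> k\<close> by auto
    next
      case 3
      have "r @ [i] = down k 1 @ [2..<Suc (j + 1)]"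
        using \<open>r = _\<close> 3 \<open>1 \<le> j\<close> by simp
      then show ?thesis using signed_suffixes_up[of "j + 1" k] 3 k weq_refl by metis
    next
      case 4
      have "r @ [i] \<approx> down k 1 @ [i] @ ?u"
        unfolding \<open>r = _\<close> append_assoc using 4 by (intro weq_append weq_refl weq_commute_word) auto
      also have "\<dots> = (down k 1 @ [i - 1 + 1]) @ ?u" using 4 by simp
      also have "\<dots> \<approx> ([i - 1] @ down k 1) @ ?u"
        using 4 k b \<open>1 \<le> j\<close> by (intro weq_append weq_refl weq_down_shift) auto
      finally have "r @ [i] \<approx> [i - 1] @ r" unfolding \<open>r = _\<close> by simp
      moreover have "1 \<le> i - 1" "i - 1 < k" using 4 k by auto
      ultimately show ?thesis using r by blast
    next
      case 5
      \<comment> \<open>The ascent raises the letter by one and the descent lowers it again, so it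
        emerges unchanged.\<close>
      have "r @ [i] \<approx> down k 1 @ [i + 1] @ ?u"
        unfolding \<open>r = _\<close> append_assoc using 5 b by (intro weq_append weq_refl weq_up_shift) auto
      also have "\<dots> = (down k 1 @ [i + 1]) @ ?u" by simp
      also have "\<dots> \<approx> ([i] @ down k 1) @ ?u"
        using 5 k b \<open>j \<le> k\<close> by (intro weq_append weq_refl weq_down_shift) auto
      finally have "r @ [i] \<approx> [i] @ r" unfolding \<open>r = _\<close> by simp
      moreover have "i < k" using 5 \<open>j \<le> k\<close> by simp
      ultimately show ?thesis using r k(1) by blast
    next
      case 6
      \<comment> \<open>Around the turn \<open>2, 1, 2\<close>, both remaining parts commute with
        the letter 1, so the four-letter relation carries it across.\<close>
      let ?x = "down k 3" and ?y = "[3..<Suc j]"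
      have "down k 1 = ?x @ [2, 1]"
        using down_snoc[of 1 k] down_snoc[of 2 k] 6 \<open>j \<le> k\<close>
        by (simp add: numeral_2_eq_2 numeral_3_eq_3 del: upt_Suc)
      moreover have "?u = 2 # ?y" using 6 upt_conv_Cons[of 2 "Suc j"] by (simp del: upt_Suc)
      ultimately have eq: "r = ?x @ [2, 1, 2] @ ?y" using \<open>r = _\<close> by simp
      have "r @ [1] \<approx> ?x @ [2, 1, 2] @ [1] @ ?y"
        unfolding eq append_assoc by (intro weq_append weq_refl weq_commute_word) auto
      also have "\<dots> = ?x @ [2, 1, 2, 1] @ ?y" by simp
      also have "\<dots> \<approx> ?x @ [1, 2, 1, 2] @ ?y"
        using weq_square[of 1] b by (intro weq_context) (simp add: weq_sym numeral_2_eq_2)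
      also have "\<dots> = (?x @ [1]) @ [2, 1, 2] @ ?y" by simp
      also have "\<dots> \<approx> ([1] @ ?x) @ [2, 1, 2] @ ?y"
        by (intro weq_append weq_refl weq_commute_word) auto
      finally have "r @ [i] \<approx> [1] @ r" unfolding eq using 6 by simp
      moreover have "1 < k" using 6 \<open>j \<le> k\<close> by simp
      ultimately show ?thesis using r by blast
    qed
  qed
qed

fun nforms :: "(nat \<Rightarrow> nat list set) \<Rightarrow> nat \<Rightarrow> nat list set" where
  "nforms R 0 = {[]}"
| "nforms R (Suc k) = {u @ r | u r. u \<in> nforms R k \<and> r \<in> R (Suc k)}"

end

text \<open>Every word over \<open>a 1, \<dots>, a k\<close> is a word over \<open>a 1, \<dots>, a (k - 1)\<close> followed by an element
  of \<open>R k\<close>, and this element is determined by the preimage of the point \<open>p k\<close>, which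
  \<open>a 1, \<dots>, a (k - 1)\<close> fix.\<close>

locale coxeter_path_normal_forms = coxeter_path a N b
  for a :: "nat \<Rightarrow> 'x \<Rightarrow> 'x" and N b :: nat +
  fixes R :: "nat \<Rightarrow> nat list set" and p :: "nat \<Rightarrow> 'x" and \<G> :: "nat \<Rightarrow> ('x \<Rightarrow> 'x) set"
  assumes R_lists: "1 \<le> k \<Longrightarrow> k \<le> N \<Longrightarrow> R k \<subseteq> lists {1..k}"
    and R_Nil: "1 \<le> k \<Longrightarrow> k \<le> N \<Longrightarrow> [] \<in> R k"
    and R_step: "1 \<le> i \<Longrightarrow> i \<le> k \<Longrightarrow> k \<le> N \<Longrightarrow> r \<in> R k \<Longrightarrow>
      (\<exists>r'\<in>R k. r @ [i] \<approx> r' \<or> (\<exists>l. 1 \<le> l \<and> l < k \<and> r @ [i] \<approx> [l] @ r'))"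
    and p_fixed: "1 \<le> i \<Longrightarrow> i < k \<Longrightarrow> k \<le> N \<Longrightarrow> a i (p k) = p k"
    and R_inj: "1 \<le> k \<Longrightarrow> k \<le> N \<Longrightarrow> r \<in> R k \<Longrightarrow> r' \<in> R k \<Longrightarrow>
      comp_list (map a r) y = p k \<Longrightarrow> comp_list (map a r') y = p k \<Longrightarrow> r = r'"
    and G_0: "\<G> 0 = {id}"
    and G_step: "1 \<le> k \<Longrightarrow> k \<le> N \<Longrightarrow> g \<in> \<G> k \<Longrightarrow>
      \<exists>r\<in>R k. g \<circ> comp_list (map a (rev r)) \<in> \<G> (k - 1)"
begin

text \<open>Letters are fed in from the right: by \<open>R_step\<close> the suffix either absorbs a
  letter or hands a smaller one to the word on its left.\<close>

lemma factor_last: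
  assumes "1 \<le> k" "k \<le> N"
  shows "w \<in> lists {1..k} \<Longrightarrow> \<exists>u\<in>lists {1..k - 1}. \<exists>r\<in>R k. w \<approx> u @ r"
proof (induction w rule: rev_induct)
  case Nil
  then show ?case using R_Nil[OF assms] by (intro bexI[of _ "[]"]) auto
next
  case (snoc i w)
  then obtain u r where ur: "u \<in> lists {1..k - 1}" "r \<in> R k" "w \<approx> u @ r" by auto
  have i: "1 \<le> i" "i \<le> k" using snoc.prems by auto
  have w: "w @ [i] \<approx> u @ (r @ [i])"
    using weq_append[OF ur(3) weq_refl[of "[i]"]] by simp
  obtain r' where r': "r' \<in> R k" "r @ [i] \<approx> r' \<or> (\<exists>l. 1 \<le> l \<and> l < k \<and> r @ [i] \<approx> [l] @ r')"
    using R_step[OF i assms(2) ur(2)] by blast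
  from r'(2) show ?case
  proof (elim disjE exE conjE)
    assume "r @ [i] \<approx> r'"
    then have "w @ [i] \<approx> u @ r'" using weq_trans[OF w weq_append[OF weq_refl]] by blast
    then show ?thesis using ur(1) r'(1) by blast
  next
    fix l assume l: "1 \<le> l" "l < k" "r @ [i] \<approx> [l] @ r'"
    then have "w @ [i] \<approx> (u @ [l]) @ r'"
      using weq_trans[OF w weq_append[OF weq_refl[of u] l(3)]] by simp
    moreover have "u @ [l] \<in> lists {1..k - 1}" using ur(1) l by auto
    ultimately show ?thesis using r'(1) by blast
  qed
qed

lemma nforms_exist: "k \<le> N \<Longrightarrow> w \<in> lists {1..k} \<Longrightarrow> \<exists>v\<in>nforms R k. w \<approx> v"
proof (induction k arbitrary: w)
  case 0
  then have "w = []" by simp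
  then show ?case by simp
next
  case (Suc k)
  obtain u r where ur: "u \<in> lists {1..k}" "r \<in> R (Suc k)" "w \<approx> u @ r"
    using factor_last[OF _ Suc.prems] by auto
  obtain v where v: "v \<in> nforms R k" "u \<approx> v" using Suc.IH[OF _ ur(1)] Suc.prems(1) by auto
  have "w \<approx> v @ r" using weq_trans[OF ur(3) weq_append[OF v(2) weq_refl]] .
  then show ?case using v(1) ur(2) by auto
qed

lemma nforms_lists: "k \<le> N \<Longrightarrow> nforms R k \<subseteq> lists {1..k}"
proof (induction k)
  case (Suc k)
  have "lists {1..k} \<subseteq> lists {1..Suc k}" by (intro lists_mono) auto
  then show ?case using Suc R_lists[of "Suc k"] by fastforce
qed simp

lemma val_inj: "k \<le> N \<Longrightarrow> u \<in> nforms R k \<Longrightarrow> v \<in> nforms R k \<Longrightarrow>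
    comp_list (map a u) = comp_list (map a v) \<Longrightarrow> u = v"
proof (induction k arbitrary: u v)
  case (Suc k)
  obtain u' r where u: "u = u' @ r" "u' \<in> nforms R k" "r \<in> R (Suc k)" using Suc.prems(2) by auto
  obtain v' q where v: "v = v' @ q" "v' \<in> nforms R k" "q \<in> R (Suc k)" using Suc.prems(3) by auto
  have k: "1 \<le> Suc k" "k \<le> N" using Suc.prems(1) by auto
  have L: "u' \<in> lists {1..N}" "v' \<in> lists {1..N}" "r \<in> lists {1..N}" "q \<in> lists {1..N}"
    using u v nforms_lists[OF k(2)] R_lists[OF k(1) Suc.prems(1)] Suc.prems(1)
    by (auto simp: in_lists_conv_set subset_iff) (meson order_trans le_Suc_eq)+
  have fixed: "comp_list (map a w) (p (Suc k)) = p (Suc k)" if "w \<in> nforms R k" for w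
    using that nforms_lists[OF k(2)] p_fixed[of _ "Suc k"] Suc.prems(1)
    by (intro comp_list_fixes) (force simp: in_lists_conv_set)
  \<comment> \<open>\<open>y\<close> is the preimage of \<open>p (Suc k)\<close> under
    \<open>r\<close>. The words \<open>u'\<close> and \<open>v'\<close> fix this point, so
    \<open>q\<close> must send \<open>y\<close> there as well, and \<open>R_inj\<close>
    applies.\<close>
  define y where "y = comp_list (map a (rev r)) (p (Suc k))"
  have ry: "comp_list (map a r) y = p (Suc k)"
    unfolding y_def using fun_cong[OF val_rev[OF L(3)]] by simp
  have eq: "comp_list (map a u') \<circ> comp_list (map a r) = comp_list (map a v') \<circ> comp_list (map a q)"
    using Suc.prems(4) u(1) v(1) by (simp only: map_append comp_list_append)
  have "comp_list (map a v') (comp_list (map a q) y) = p (Suc k)"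
    using fun_cong[OF eq, of y] ry fixed[OF u(2)] by simp
  then have "comp_list (map a q) y = comp_list (map a (rev v')) (p (Suc k))"
    using fun_cong[OF val_rev'[OF L(2)], of "comp_list (map a q) y"] by simp
  also have "\<dots> = p (Suc k)"
    using fun_cong[OF val_rev'[OF L(2)], of "p (Suc k)"] fixed[OF v(2)] by simp
  finally have rq: "r = q" using R_inj[OF k(1) Suc.prems(1) u(3) v(3) ry] by simp
  have "comp_list (map a u') \<circ> (comp_list (map a r) \<circ> comp_list (map a (rev r))) =
      comp_list (map a v') \<circ> (comp_list (map a r) \<circ> comp_list (map a (rev r)))"
    using eq unfolding rq o_assoc by (simp only:)
  then have "comp_list (map a u') = comp_list (map a v')" unfolding val_rev[OF L(3)] comp_id .
  then have "u' = v'" using Suc.IH[OF k(2) u(2) v(2)] by simp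
  then show ?case using u(1) v(1) rq by simp
qed simp

text \<open>This direction serves the generation of the group; the completeness of the relations
  rests on \<open>val_inj\<close>.\<close>

lemma val_surj: "k \<le> N \<Longrightarrow> \<G> k \<subseteq> (\<lambda>u. comp_list (map a u)) ` nforms R k"
proof (induction k)
  case 0
  then show ?case by (simp add: G_0 fun_eq_iff)
next
  case (Suc k)
  show ?case
  proof
    fix g assume "g \<in> \<G> (Suc k)"
    then obtain r where r: "r \<in> R (Suc k)" "g \<circ> comp_list (map a (rev r)) \<in> \<G> k"
      using G_step[of "Suc k" g] Suc.prems by auto
    then obtain u where u: "u \<in> nforms R k" "g \<circ> comp_list (map a (rev r)) = comp_list (map a u)"
      using Suc by auto
    have "r \<in> lists {1..N}"
      using r(1) R_lists[of "Suc k"] Suc.prems by (force simp: in_lists_conv_set)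
    then have "g = g \<circ> (comp_list (map a (rev r)) \<circ> comp_list (map a r))"
      by (simp only: val_rev' comp_id)
    also have "\<dots> = comp_list (map a (u @ r))"
      unfolding o_assoc u(2) map_append comp_list_append ..
    finally show "g \<in> (\<lambda>u. comp_list (map a u)) ` nforms R (Suc k)" using u(1) r(1)
      by (intro image_eqI[of _ _ "u @ r"]) auto
  qed
qed

text \<open>Both words are congruent to normal forms, whose values agree by soundness; by
  \<open>val_inj\<close> it is one normal form.\<close>

lemma ceq_complete:
  assumes "u \<in> lists S" "v \<in> lists S" "comp_list u = comp_list v"
  shows "ceq u v"
proof -
  obtain x y where xy: "x \<in> lists {1..N}" "y \<in> lists {1..N}" "u = map a x" "v = map a y"
    using assms(1,2) unfolding lists_image by auto
  obtain x' y' where n: "x' \<in> nforms R N" "x \<approx> x'" "y' \<in> nforms R N" "y \<approx> y'"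
    using nforms_exist[of N x] nforms_exist[of N y] xy by auto
  have c: "ceq u (map a x')" "ceq v (map a y')" using n(2,4) xy unfolding weq_def by auto
  then have "comp_list (map a x') = comp_list (map a y')" using ceq_sound assms(3) by metis
  then have "x' = y'" using val_inj n(1,3) by blast
  then show ?thesis using c by (metis coxeter_eq.sym coxeter_eq.trans)
qed

lemma coxeter_system_path:
  fixes G :: "('x \<Rightarrow> 'x) monoid"
  assumes G: "group G" "carrier G = \<G> N" and S: "S \<subseteq> carrier G" and wp: "word_prod G = comp_list"
    and mult: "\<And>x y. x \<otimes>\<^bsub>G\<^esub> y = x \<circ> y" "\<one>\<^bsub>G\<^esub> = id"
  shows "coxeter_system G S"
proof -
  have gen: "comp_list ts \<in> generate G S" if "ts \<in> lists S" for ts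
    using that
  proof (induction ts)
    case Nil
    show ?case using generate.one[of G S] unfolding mult(2) comp_list_Nil .
  next
    case (Cons t ts)
    then have "t \<in> S" "comp_list ts \<in> generate G S" by auto
    from generate.eng[OF generate.incl[OF this(1)] this(2)] show ?case
      unfolding mult(1) comp_list_Cons .
  qed
  have "carrier G \<subseteq> generate G S"
  proof
    fix g assume "g \<in> carrier G"
    then obtain u where u: "u \<in> nforms R N" "g = comp_list (map a u)" using val_surj[of N] G(2) by auto
    have "u \<in> lists {1..N}" using u(1) nforms_lists[of N] by auto
    then show "g \<in> generate G S" unfolding u(2) by (intro gen map_S)
  qed
  moreover have "generate G S \<subseteq> carrier G" using group.generate_in_carrier[OF G(1) S] by auto
  ultimately have "generate G S = carrier G" by (rule antisym[rotated])
  moreover have "\<forall>u\<in>lists S. \<forall>v\<in>lists S. comp_list u = comp_list v \<longleftrightarrow> ceq u v"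
    using ceq_sound ceq_complete by blast
  ultimately show ?thesis
    unfolding coxeter_system_def wp
    using G(1) S coxeter_matrix_small_order[of S] by (intro conjI exI[of _ small_order])
qed

end

section \<open>The Coxeter systems of types A and B\<close>

lemma comp_list_permutes: "(\<And>t. t \<in> set ts \<Longrightarrow> t permutes D) \<Longrightarrow> comp_list ts permutes D"
proof (induction ts)
  case (Cons t ts)
  then have "comp_list ts permutes D" "t permutes D" by simp_all
  then show ?case unfolding comp_list_Cons by (rule permutes_compose)
qed (simp add: permutes_id)

declare upt_Suc [simp del]

section \<open>Type A: neighbouring transpositions along an injective sequence\<close>

lemma coxeter_path_transpose:
  assumes "inj q"
  shows "coxeter_path (\<lambda>i. transpose (q (i - 1)) (q i)) N 1"
proof
  fix i j :: nat assume "1 \<le> i" "i + 2 \<le> j"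
  then have "q (i - 1) \<noteq> q (j - 1)" "q (i - 1) \<noteq> q j" "q i \<noteq> q (j - 1)" "q i \<noteq> q j"
    using assms by (simp_all add: inj_eq)
  then show "transpose (q (i - 1)) (q i) \<circ> transpose (q (j - 1)) (q j) =
      transpose (q (j - 1)) (q j) \<circ> transpose (q (i - 1)) (q i)"
    by (auto simp: fun_eq_iff transpose_def)
next
  fix i :: nat assume "1 \<le> i"
  then have "q (i - 1) \<noteq> q i" "q (i - 1) \<noteq> q (i + 1)" "q i \<noteq> q (i + 1)"
    using assms by (simp_all add: inj_eq)
  then show "transpose (q (i - 1)) (q i) \<circ> transpose (q (i + 1 - 1)) (q (i + 1)) \<circ> transpose (q (i - 1)) (q i) =
      transpose (q (i + 1 - 1)) (q (i + 1)) \<circ> transpose (q (i - 1)) (q i) \<circ> transpose (q (i + 1 - 1)) (q (i + 1))"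
    by (auto simp: fun_eq_iff transpose_def)
qed simp_all

text \<open>\<open>down k j\<close> carries \<open>q (j - 1)\<close> to \<open>q k\<close>, so the
  \<open>k + 1\<close> suffixes correspond to the possible preimages of \<open>q k\<close> among the
  first \<open>k + 1\<close> points.\<close>

lemma coxeter_path_normal_forms_transpose:
  assumes q: "inj q"
  shows "coxeter_path_normal_forms (\<lambda>i. transpose (q (i - 1)) (q i)) N 1
    (\<lambda>k. {down k j | j. 1 \<le> j \<and> j \<le> k + 1}) q (\<lambda>k. {g. g permutes q ` {0..k}})"
proof -
  let ?a = "\<lambda>i. transpose (q (i - 1)) (q i)"
  interpret coxeter_path ?a N 1 by (rule coxeter_path_transpose) fact
  have val: "comp_list (map ?a (down k j)) (q (j - 1)) = q k" if "1 \<le> j" "j \<le> k + 1" for k j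
    using that
  proof (induction k)
    case (Suc k)
    show ?case
    proof (cases "j = k + 2")
      case False
      then have "down (Suc k) j = Suc k # down k j" using Suc.prems by (simp add: upt_Suc)
      then show ?thesis using Suc False by simp
    qed simp
  qed simp
  show ?thesis
  proof
    fix k
    have "down k j \<in> lists {1..k}" if "1 \<le> j" for j using that by (simp add: in_lists_conv_set)
    then show "{down k j | j. 1 \<le> j \<and> j \<le> k + 1} \<subseteq> lists {1..k}" by blast
  next
    fix k show "[] \<in> {down k j | j. 1 \<le> j \<and> j \<le> k + 1}" by (auto intro!: exI[of _ "k + 1"])
  next
    fix i k r assume "1 \<le> i" "i \<le> k" "k \<le> N" "r \<in> {down k j | j. 1 \<le> j \<and> j \<le> k + 1}"
    then show "\<exists>r'\<in>{down k j | j. 1 \<le> j \<and> j \<le> k + 1}.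
        weq (r @ [i]) r' \<or> (\<exists>l. 1 \<le> l \<and> l < k \<and> weq (r @ [i]) ([l] @ r'))"
      using down_suffixes_step[OF HOL.refl] by blast
  next
    fix i k :: nat assume "1 \<le> i" "i < k"
    then show "transpose (q (i - 1)) (q i) (q k) = q k"
      using q by (simp add: transpose_def inj_eq)
  next
    fix k r r' y
    assume k: "k \<le> N" and "r \<in> {down k j | j. 1 \<le> j \<and> j \<le> k + 1}" "r' \<in> {down k j | j. 1 \<le> j \<and> j \<le> k + 1}"
      and y: "comp_list (map ?a r) y = q k" "comp_list (map ?a r') y = q k"
    then obtain j j' where j: "r = down k j" "1 \<le> j" "j \<le> k + 1" "r' = down k j'" "1 \<le> j'" "j' \<le> k + 1"
      by blast
    have lists: "r \<in> lists {1..N}" "r' \<in> lists {1..N}" using j k by auto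
    have "comp_list (map ?a r) (q (j - 1)) = q k" "comp_list (map ?a r') (q (j' - 1)) = q k"
      unfolding j(1,4) by (rule val[OF j(2,3)], rule val[OF j(5,6)])
    note w = val_rev_apply[OF lists(1) this(1)] val_rev_apply[OF lists(2) this(2)]
    have "q (j - 1) = y" "q (j' - 1) = y"
      using val_rev_apply[OF lists(1) y(1)] w(1) val_rev_apply[OF lists(2) y(2)] w(2) by (simp_all only:)
    then have "q (j - 1) = q (j' - 1)" by (simp only:)
    then have "j - 1 = j' - 1" by (rule injD[OF q])
    then show "r = r'" using j by (metis Suc_pred' less_le_trans zero_less_one)
  next
    show "{g. g permutes q ` {0..0}} = {id}" by (auto simp: permutes_sing permutes_id)
  next
    fix k g assume k: "1 \<le> k" "k \<le> N" and "g \<in> {g. g permutes q ` {0..k}}"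
    then have g: "g permutes q ` {0..k}" by simp
    have "inv_into UNIV g (q k) \<in> q ` {0..k}"
      using permutes_in_image[OF permutes_inv[OF g]] by simp
    then obtain l where l: "l \<le> k" "inv_into UNIV g (q k) = q l" by auto
    then have gl: "g (q l) = q k" using permutes_inverses(1)[OF g, of "q k"] by simp
    \<comment> \<open>This suffix sends \<open>q l\<close>, the preimage of \<open>q k\<close> under
      \<open>g\<close>, to \<open>q k\<close>; composing \<open>g\<close> with its reversal
      therefore fixes \<open>q k\<close>.\<close>
    let ?r = "down k (l + 1)"
    let ?h = "comp_list (map ?a (rev ?r))"
    have h: "?h permutes q ` {0..k}"
      using l(1) by (intro comp_list_permutes) (auto intro!: permutes_swap_id)
    have "?h (q k) = q l"
    proof (rule val_rev_apply)
      show "?r \<in> lists {1..N}" using l(1) k(2) by (auto simp: in_lists_conv_set)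
      show "comp_list (map ?a ?r) (q l) = q k" using val[of "l + 1" k] l(1) by simp
    qed
    then have "(g \<circ> ?h) (q k) = q k" using gl by simp
    moreover have gh: "g \<circ> ?h permutes q ` {0..k}" using h g by (rule permutes_compose)
    ultimately have "g \<circ> ?h permutes q ` {0..k - 1}"
    proof (intro permutes_superset[OF gh])
      fix x assume "(g \<circ> ?h) (q k) = q k" "x \<in> q ` {0..k} - q ` {0..k - 1}"
      moreover have "{0..k} = insert k {0..k - 1}" using k by auto
      ultimately show "(g \<circ> ?h) x = x" by auto
    qed
    then show "\<exists>r\<in>{down k j | j. 1 \<le> j \<and> j \<le> k + 1}.
        g \<circ> comp_list (map ?a (rev r)) \<in> {g. g permutes q ` {0..k - 1}}"
      using l(1) by (intro bexI[of _ ?r]) auto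
  qed
qed

text \<open>The increasing enumeration of \<open>Omega n\<close> from index 0; the extra 1 skips the
  number 0. It continues past \<open>2 * n - 1\<close> so as to be injective on all natural
  numbers.\<close>

definition Omega_nth :: "nat \<Rightarrow> nat \<Rightarrow> int" where
  "Omega_nth n i = (if i < n then int i - int n else int i - int n + 1)"

lemma strict_mono_Omega_nth: "strict_mono (Omega_nth n)"
  by (auto simp: strict_mono_def Omega_nth_def)

lemma Omega_nth_image:
  assumes "n \<ge> 1"
  shows "Omega_nth n ` {0..2 * n - 1} = Omega n"
proof (intro equalityI subsetI)
  fix x assume x: "x \<in> Omega n"
  let ?i = "nat (if x < 0 then x + int n else x + int n - 1)"
  have "Omega_nth n ?i = x" "?i \<le> 2 * n - 1"
    using x by (auto simp: Omega_nth_def Omega_iff)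
  then show "x \<in> Omega_nth n ` {0..2 * n - 1}" by (intro image_eqI[of _ _ ?i]) auto
qed (use assms in \<open>auto simp: Omega_nth_def Omega_iff\<close>)

lemma sym_Omega_gens_eq:
  assumes "n \<ge> 1"
  shows "sym_Omega_gens n = (\<lambda>i. transpose (Omega_nth n (i - 1)) (Omega_nth n i)) ` {1..2 * n - 1}"
proof (intro equalityI subsetI)
  fix t assume "t \<in> sym_Omega_gens n"
  then obtain i j where t: "t = transpose i j" "i \<in> Omega n" "j \<in> Omega n" "i < j"
    "\<forall>k\<in>Omega n. \<not> (i < k \<and> k < j)"
    unfolding sym_Omega_gens_def by blast
  then obtain k l where kl: "i = Omega_nth n k" "j = Omega_nth n l" "l \<le> 2 * n - 1"
    unfolding Omega_nth_image[OF assms, symmetric] by auto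
  have "k < l" using t(4) strict_mono_less[OF strict_mono_Omega_nth] kl by simp
  moreover have "\<not> k + 1 < l"
  proof
    assume "k + 1 < l"
    then have "Omega_nth n (k + 1) \<in> Omega n"
      unfolding Omega_nth_image[OF assms, symmetric] using kl(3) by auto
    then show False
      using t(5) kl \<open>k + 1 < l\<close> strict_mono_less[OF strict_mono_Omega_nth] by auto
  qed
  ultimately have "l = k + 1" by simp
  then show "t \<in> (\<lambda>i. transpose (Omega_nth n (i - 1)) (Omega_nth n i)) ` {1..2 * n - 1}"
    using kl t(1) by (intro image_eqI[of _ _ l]) auto
next
  fix t assume "t \<in> (\<lambda>i. transpose (Omega_nth n (i - 1)) (Omega_nth n i)) ` {1..2 * n - 1}"
  then obtain i where i: "1 \<le> i" "i \<le> 2 * n - 1" "t = transpose (Omega_nth n (i - 1)) (Omega_nth n i)"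
    by auto
  have O: "Omega_nth n (i - 1) \<in> Omega n" "Omega_nth n i \<in> Omega n"
    unfolding Omega_nth_image[OF assms, symmetric] using i(1,2) by auto
  have "\<not> (Omega_nth n (i - 1) < k \<and> k < Omega_nth n i)" if k: "k \<in> Omega n" for k
  proof -
    obtain l where "k = Omega_nth n l" using k unfolding Omega_nth_image[OF assms, symmetric] by auto
    then show ?thesis using strict_mono_less[OF strict_mono_Omega_nth] i(1) by auto
  qed
  moreover have "Omega_nth n (i - 1) < Omega_nth n i"
    using strict_mono_less[OF strict_mono_Omega_nth] i(1) by simp
  ultimately show "t \<in> sym_Omega_gens n"
    unfolding sym_Omega_gens_def i(3) using O by blast
qed

lemma sym_Omega_gens_subset: "sym_Omega_gens n \<subseteq> carrier (sym_Omega n)"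
  by (auto simp: sym_Omega_gens_def intro!: permutes_swap_id)

lemma coxeter_system_sym_Omega:
  assumes "n \<ge> 1"
  shows "coxeter_system (sym_Omega n) (sym_Omega_gens n)"
proof -
  interpret coxeter_path_normal_forms "\<lambda>i. transpose (Omega_nth n (i - 1)) (Omega_nth n i)" "2 * n - 1" 1
    "\<lambda>k. {down k j | j. 1 \<le> j \<and> j \<le> k + 1}" "Omega_nth n"
    "\<lambda>k. {g. g permutes Omega_nth n ` {0..k}}"
    by (rule coxeter_path_normal_forms_transpose) (rule strict_mono_imp_inj_on[OF strict_mono_Omega_nth])
  show ?thesis
    unfolding sym_Omega_gens_eq[OF assms]
  proof (rule coxeter_system_path[OF group_sym_Omega _ _ word_prod_sym_Omega])
    show "carrier (sym_Omega n) = {g. g permutes Omega_nth n ` {0..2 * n - 1}}"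
      unfolding Omega_nth_image[OF assms] by simp
  qed (use sym_Omega_gens_subset[of n] in \<open>simp_all only: sym_Omega_gens_eq[OF assms, symmetric] sym_Omega_sel\<close>)
qed

section \<open>Type B: generators and normal forms of the hyperoctahedral group\<close>

definition signed_gen :: "nat \<Rightarrow> nat \<Rightarrow> int \<Rightarrow> int" where
  "signed_gen n i = (if i = 1 then signed_swap (int n) (- int n)
     else signed_swap (int n - int i + 1) (int n - int i + 2))"

text \<open>Points and generators are numbered downwards from \<open>n\<close>, which puts the edge
  labelled 4 at the start of the path. Generator 1 changes the sign of point 1, generator
  \<open>i\<close> swaps points \<open>i\<close> and \<open>i - 1\<close>, and point
  \<open>k\<close> is fixed by all generators below \<open>k\<close>.\<close>

definition signed_point :: "nat \<Rightarrow> nat \<Rightarrow> int" where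
  "signed_point n i = int n - int i + 1"

lemma signed_point_Omega: "1 \<le> i \<Longrightarrow> i \<le> n \<Longrightarrow> signed_point n i \<in> Omega n"
  by (auto simp: signed_point_def Omega_iff)

lemma signed_gen_hyperoctahedral:
  assumes "1 \<le> i" "i \<le> n"
  shows "signed_gen n i \<in> hyperoctahedral n"
  unfolding signed_gen_def using assms
  by (auto intro!: signed_swap_hyperoctahedral simp: Omega_iff)

lemma signed_gen_invol:
  assumes "1 \<le> i" "i \<le> n"
  shows "signed_gen n i \<circ> signed_gen n i = id"
  unfolding signed_gen_def using assms signed_swap_invol by (auto simp: fun_eq_iff)

lemma signed_gen_fixes: "1 \<le> i \<Longrightarrow> i < k \<Longrightarrow> k \<le> n \<Longrightarrow> signed_gen n i (signed_point n k) = signed_point n k"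
  by (auto simp: signed_gen_def signed_point_def signed_swap_def)

lemma signed_gen_alt: "2 \<le> i \<Longrightarrow> signed_gen n i = signed_swap (signed_point n i) (signed_point n (i - 1))"
  by (simp add: signed_gen_def signed_point_def algebra_simps of_nat_diff)

lemma hyperoctahedral_comp_signed_swap:
  assumes "w \<in> hyperoctahedral n"
  shows "w \<circ> signed_swap i j = signed_swap (w i) (w j) \<circ> w"
proof -
  have "w permutes Omega n" using assms by (simp add: hyperoctahedral_iff)
  then show ?thesis
    by (intro comp_signed_swap permutes_inj hyperoctahedral_minus[OF assms])
qed

text \<open>The relations come from conjugating signed swaps. Both sides of the braid relation are
  the reflection that exchanges points \<open>i - 1\<close> and \<open>i + 1\<close>; the
  four-letter relation says that the sign change at \<open>n\<close> commutes with
  \<open>?t \<circ> ?s \<circ> ?t\<close>, the sign change at \<open>n - 1\<close>.\<close>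

lemma coxeter_path_signed: "coxeter_path (signed_gen n) n 2"
proof
  fix i j assume ij: "1 \<le> i" "i + 2 \<le> j" "j \<le> n"
  have "signed_gen n i (signed_point n j) = signed_point n j"
    "signed_gen n i (signed_point n (j - 1)) = signed_point n (j - 1)"
    using signed_gen_fixes ij by simp_all
  then show "signed_gen n i \<circ> signed_gen n j = signed_gen n j \<circ> signed_gen n i"
    using hyperoctahedral_comp_signed_swap[OF signed_gen_hyperoctahedral[of i n]] ij
    by (simp only: signed_gen_alt[of j])
next
  fix i assume i: "2 \<le> i" "i < n"
  let ?s = "signed_gen n i" and ?t = "signed_gen n (i + 1)"
  let ?x = "signed_point n (i - 1)" and ?y = "signed_point n i" and ?z = "signed_point n (i + 1)"
  have st: "?s = signed_swap ?y ?x" "?t = signed_swap ?z ?y"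
    using signed_gen_alt[of i n] signed_gen_alt[of "i + 1" n] i by simp_all
  have ne: "?x \<noteq> ?y" "?y \<noteq> ?z" "?x \<noteq> ?z" "?x \<noteq> - ?y" "?x \<noteq> - ?z" "?y \<noteq> - ?z"
    using i by (auto simp: signed_point_def)
  have vals: "?s ?z = ?z" "?s ?y = ?x" "?t ?y = ?z" "?t ?x = ?x"
    unfolding st using ne by (auto simp: signed_swap_def)
  have "?s \<circ> ?t = signed_swap ?z ?x \<circ> ?s"
    using hyperoctahedral_comp_signed_swap[OF signed_gen_hyperoctahedral[of i n], of ?z ?y] i vals st(2)
    by simp
  then have "?s \<circ> ?t \<circ> ?s = signed_swap ?z ?x"
    using signed_gen_invol[of i n] i by (simp only: comp_assoc comp_id)
  moreover have "?t \<circ> ?s = signed_swap ?z ?x \<circ> ?t"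
    using hyperoctahedral_comp_signed_swap[OF signed_gen_hyperoctahedral[of "i + 1" n], of ?y ?x] i vals st(1)
    by simp
  then have "?t \<circ> ?s \<circ> ?t = signed_swap ?z ?x"
    using signed_gen_invol[of "i + 1" n] i by (simp only: comp_assoc comp_id)
  ultimately show "?s \<circ> ?t \<circ> ?s = ?t \<circ> ?s \<circ> ?t" by (simp only:)
next
  fix i :: nat assume "1 \<le> i" "i < 2" "i < n"
  then have i: "i = 1" "2 \<le> n" by simp_all
  let ?s = "signed_gen n 1" and ?t = "signed_gen n 2" and ?u = "signed_swap (int n - 1) (- (int n - 1))"
  have s: "?s = signed_swap (int n) (- int n)" and t: "?t = signed_swap (int n - 1) (int n)"
    by (simp_all add: signed_gen_def)
  have h: "?s \<in> hyperoctahedral n" "?t \<in> hyperoctahedral n"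
    using signed_gen_hyperoctahedral i by simp_all
  have "?t (int n) = int n - 1" "?t (- int n) = - (int n - 1)"
    unfolding t using i by (auto simp: signed_swap_def)
  then have "?t \<circ> ?s = ?u \<circ> ?t"
    using hyperoctahedral_comp_signed_swap[OF h(2), of "int n" "- int n"] s by simp
  then have tst: "?t \<circ> ?s \<circ> ?t = ?u"
    using signed_gen_invol[of 2 n] i by (simp only: comp_assoc comp_id)
  have "?s (int n - 1) = int n - 1" "?s (- (int n - 1)) = - (int n - 1)"
    unfolding s using i by (auto simp: signed_swap_def)
  then have "?s \<circ> ?u = ?u \<circ> ?s"
    using hyperoctahedral_comp_signed_swap[OF h(1), of "int n - 1" "- (int n - 1)"] by simp
  then have "?s \<circ> ?t \<circ> ?s \<circ> ?t = ?t \<circ> ?s \<circ> ?t \<circ> ?s"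
    unfolding tst[symmetric] o_assoc .
  then show "signed_gen n i \<circ> signed_gen n (i + 1) \<circ> signed_gen n i \<circ> signed_gen n (i + 1) =
      signed_gen n (i + 1) \<circ> signed_gen n i \<circ> signed_gen n (i + 1) \<circ> signed_gen n i"
    unfolding i(1) one_add_one .
qed (use signed_gen_invol in simp_all)

text \<open>Read from the right, the ascent brings minus point \<open>j\<close> to minus point 1,
  generator 1 flips the sign, and the descent climbs to point \<open>k\<close>. So the preimage of
  point \<open>k\<close> has negative sign exactly for the suffixes with a full descent.\<close>

lemma signed_suffix_values:
  assumes "1 \<le> j" "j \<le> k" "k \<le> n"
  shows "comp_list (map (signed_gen n) (down k (j + 1))) (signed_point n j) = signed_point n k"
    and "comp_list (map (signed_gen n) (down k 1 @ [2..<Suc j])) (- signed_point n j) = signed_point n k"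
proof -
  have D: "comp_list (map (signed_gen n) (down k (j + 1))) (signed_point n j) = signed_point n k"
    if "1 \<le> j" "j \<le> k" "k \<le> n" for j k
    using that
  proof (induction k)
    case (Suc k)
    show ?case
    proof (cases "j = Suc k")
      case False
      then have "down (Suc k) (j + 1) = Suc k # down k (j + 1)" using Suc.prems by (simp add: upt_Suc)
      moreover have "signed_gen n (Suc k) (signed_point n k) = signed_point n (Suc k)"
        using False Suc.prems by (subst signed_gen_alt) (auto simp: signed_swap_def)
      ultimately show ?thesis using Suc False by simp
    qed simp
  qed simp
  have U: "comp_list (map (signed_gen n) [2..<Suc j]) (- signed_point n j) = - signed_point n 1"
    if "1 \<le> j" "j \<le> n" for j
    using that
  proof (induction j)
    case (Suc j)
    show ?case
    proof (cases "j = 0")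
      case False
      then have "[2..<Suc (Suc j)] = [2..<Suc j] @ [Suc j]" by (simp add: upt_Suc)
      moreover have "signed_gen n (Suc j) (- signed_point n (Suc j)) = - signed_point n j"
        using False Suc.prems
        by (subst signed_gen_alt) (auto simp: signed_swap_def signed_point_def)
      ultimately show ?thesis using Suc False by (simp del: upt_Suc)
    qed simp
  qed simp
  show "comp_list (map (signed_gen n) (down k (j + 1))) (signed_point n j) = signed_point n k"
    using D assms .
  have "down k 1 = down k 2 @ [1]" using down_snoc[of 1 k] assms by (simp add: numeral_2_eq_2 del: upt_Suc)
  moreover have "signed_gen n 1 (- signed_point n 1) = signed_point n 1"
    by (auto simp: signed_gen_def signed_swap_def signed_point_def)
  ultimately have "comp_list (map (signed_gen n) (down k 1)) (- signed_point n 1) = signed_point n k"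
    using D[of 1 k, unfolded one_add_one] assms by (simp del: upt_Suc)
  then show "comp_list (map (signed_gen n) (down k 1 @ [2..<Suc j])) (- signed_point n j) = signed_point n k"
    using U[of j] assms unfolding map_append comp_list_append by simp
qed

lemma coxeter_path_normal_forms_signed:
  "coxeter_path_normal_forms (signed_gen n) n 2 signed_suffixes (signed_point n)
    (\<lambda>k. {g \<in> hyperoctahedral n. \<forall>i. k < i \<longrightarrow> i \<le> n \<longrightarrow> g (signed_point n i) = signed_point n i})"
proof -
  interpret coxeter_path "signed_gen n" n 2 by (rule coxeter_path_signed)
  have R_lists: "r \<in> lists {1..k}" if "r \<in> signed_suffixes k" for r k
    using that by (auto simp: signed_suffixes_def)
  have lists: "r \<in> lists {1..n}" if "r \<in> signed_suffixes k" "k \<le> n" for r k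
    using R_lists[OF that(1)] that(2) by (auto simp: in_lists_conv_set)
  have unique: "y = z" if "r \<in> signed_suffixes k" "k \<le> n"
    "comp_list (map (signed_gen n) r) y = x" "comp_list (map (signed_gen n) r) z = x" for r k x y z
    using val_rev_apply[OF lists[OF that(1,2)] that(3)] val_rev_apply[OF lists[OF that(1,2)] that(4)]
    by simp
  show ?thesis
  proof
    fix k show "signed_suffixes k \<subseteq> lists {1..k}" using R_lists by blast
  next
    fix k :: nat assume "1 \<le> k"
    then show "[] \<in> signed_suffixes k" using signed_suffixes_down[of "k + 1" k] by simp
  next
    fix i k r assume "1 \<le> i" "i \<le> k" "k \<le> n" "r \<in> signed_suffixes k"
    then show "\<exists>r'\<in>signed_suffixes k. weq (r @ [i]) r' \<or>
        (\<exists>l. 1 \<le> l \<and> l < k \<and> weq (r @ [i]) ([l] @ r'))"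
      by (rule signed_suffixes_step[OF HOL.refl])
  next
    fix i k assume "1 \<le> i" "i < k" "k \<le> n"
    then show "signed_gen n i (signed_point n k) = signed_point n k" by (rule signed_gen_fixes)
  next
    fix k r r' y
    assume k: "k \<le> n" and r: "r \<in> signed_suffixes k" "r' \<in> signed_suffixes k"
      and y: "comp_list (map (signed_gen n) r) y = signed_point n k"
        "comp_list (map (signed_gen n) r') y = signed_point n k"
    have shape: "\<exists>j. 1 \<le> j \<and> j \<le> k \<and> (q = down k (j + 1) \<and> y = signed_point n j \<or>
        q = down k 1 @ [2..<Suc j] \<and> y = - signed_point n j)"
      if q: "q \<in> signed_suffixes k" "comp_list (map (signed_gen n) q) y = signed_point n k" for q
    proof -
      from q(1) consider j where "q = down k (j + 1)" "1 \<le> j" "j \<le> k"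
        | j where "q = down k 1 @ [2..<Suc j]" "1 \<le> j" "j \<le> k"
        unfolding signed_suffixes_def by blast
      then show ?thesis
        using unique[OF q(1) k q(2)] signed_suffix_values[OF _ _ k] by cases blast+
    qed
    obtain j where j: "1 \<le> j" "j \<le> k" "r = down k (j + 1) \<and> y = signed_point n j \<or>
        r = down k 1 @ [2..<Suc j] \<and> y = - signed_point n j"
      using shape[OF r(1) y(1)] by blast
    obtain j' where j': "1 \<le> j'" "j' \<le> k" "r' = down k (j' + 1) \<and> y = signed_point n j' \<or>
        r' = down k 1 @ [2..<Suc j'] \<and> y = - signed_point n j'"
      using shape[OF r(2) y(2)] by blast
    \<comment> \<open>All points are positive, so the sign of \<open>y\<close> decides the kind of
      suffix and its absolute value the index.\<close>
    have "signed_point n j > 0" "signed_point n j' > 0" using j j' k by (auto simp: signed_point_def)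
    moreover have "signed_point n j = signed_point n j' \<Longrightarrow> j = j'" by (simp add: signed_point_def)
    ultimately show "r = r'" using j(3) j'(3) by auto
  next
    show "{g \<in> hyperoctahedral n. \<forall>i>0. i \<le> n \<longrightarrow> g (signed_point n i) = signed_point n i} = {id}"
    proof (intro equalityI subsetI)
      fix g assume g: "g \<in> {g \<in> hyperoctahedral n. \<forall>i>0. i \<le> n \<longrightarrow> g (signed_point n i) = signed_point n i}"
      have pos: "g x = x" if "0 < x" "x \<le> int n" for x
        using g that by (auto simp: signed_point_def dest!: spec[of _ "nat (int n - x + 1)"])
      have "g x = x" for x
      proof (cases "x \<in> Omega n")
        case True
        then show ?thesis
          using pos[of x] pos[of "- x"] g hyperoctahedral_minus[of g n x]
          by (cases "x > 0") (auto simp: Omega_iff)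
      next
        case False
        then show ?thesis using g permutes_not_in[of g "Omega n"] by (simp add: hyperoctahedral_iff)
      qed
      then show "g \<in> {id}" by auto
    qed (use id_hyperoctahedral in auto)
  next
    fix k g assume k: "1 \<le> k" "k \<le> n"
      and "g \<in> {g \<in> hyperoctahedral n. \<forall>i>k. i \<le> n \<longrightarrow> g (signed_point n i) = signed_point n i}"
    then have g: "g \<in> hyperoctahedral n" "\<And>i. k < i \<Longrightarrow> i \<le> n \<Longrightarrow> g (signed_point n i) = signed_point n i"
      by auto
    have gp: "g permutes Omega n" using g(1) by (simp add: hyperoctahedral_iff)
    define y where "y = inv_into UNIV g (signed_point n k)"
    have y: "g y = signed_point n k" "y \<in> Omega n"
      unfolding y_def using permutes_inverses(1)[OF gp] permutes_in_image[OF permutes_inv[OF gp]]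
        signed_point_Omega[OF k] by simp_all
    \<comment> \<open>The index with \<open>signed_point n j = \<bar>y\<bar>\<close>.\<close>
    define j where "j = nat (int n - \<bar>y\<bar> + 1)"
    have j: "1 \<le> j" "j \<le> n" "y = signed_point n j \<or> y = - signed_point n j"
      unfolding j_def using y(2) by (auto simp: signed_point_def Omega_iff)
    \<comment> \<open>Beyond \<open>k\<close>, oddness would make \<open>g\<close> fix
      \<open>y\<close> whatever its sign; then \<open>y\<close> would be point \<open>k\<close>
      itself.\<close>
    have "j \<le> k"
    proof (rule ccontr)
      assume "\<not> j \<le> k"
      then have "g (signed_point n j) = signed_point n j" using g(2) j(2) by simp
      then have "g y = y" using j(3) hyperoctahedral_minus[OF g(1)] by auto
      then show False using y(1) j \<open>\<not> j \<le> k\<close> k by (auto simp: signed_point_def)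
    qed
    then obtain r where r: "r \<in> signed_suffixes k" "comp_list (map (signed_gen n) r) y = signed_point n k"
      using j signed_suffix_values[OF j(1) _ k(2)] signed_suffixes_down[of "j + 1" k]
        signed_suffixes_up[of j k] k(1) by (metis add_le_mono1 le_add2)
    let ?h = "comp_list (map (signed_gen n) (rev r))"
    have letters: "1 \<le> l \<and> l \<le> k" if "l \<in> set r" for l
      using that R_lists[OF r(1)] by (auto simp: in_lists_conv_set)
    have h: "?h \<in> hyperoctahedral n"
    proof -
      have "comp_list (map (signed_gen n) u) \<in> hyperoctahedral n" if "set u \<subseteq> {1..k}" for u
        using that
      proof (induction u)
        case Nil
        show ?case using id_hyperoctahedral by (simp only: list.map comp_list_Nil)
      next
        case (Cons l u)
        then have "signed_gen n l \<in> hyperoctahedral n"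
          using signed_gen_hyperoctahedral[of l n] k by simp
        moreover have "comp_list (map (signed_gen n) u) \<in> hyperoctahedral n" using Cons by simp
        ultimately show ?case unfolding list.map comp_list_Cons by (rule hyperoctahedral_comp)
      qed
      moreover have "set (rev r) \<subseteq> {1..k}" using letters by auto
      ultimately show ?thesis .
    qed
    have "?h (signed_point n k) = y"
      using val_rev_apply[OF lists[OF r(1) k(2)] r(2)] .
    then have "(g \<circ> ?h) (signed_point n k) = signed_point n k" using y(1) by simp
    moreover have "(g \<circ> ?h) (signed_point n i) = signed_point n i" if "k < i" "i \<le> n" for i
    proof -
      have "?h (signed_point n i) = signed_point n i"
        using letters that by (intro comp_list_fixes) (auto intro!: signed_gen_fixes dest!: letters)
      then show ?thesis using g(2)[OF that] by simp
    qed
    ultimately have "(g \<circ> ?h) (signed_point n i) = signed_point n i" if "k - 1 < i" "i \<le> n" for i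
      using that by (cases "i = k") auto
    moreover have "g \<circ> ?h \<in> hyperoctahedral n" using hyperoctahedral_comp[OF g(1) h] .
    ultimately show "\<exists>r\<in>signed_suffixes k. g \<circ> comp_list (map (signed_gen n) (rev r)) \<in>
        {g \<in> hyperoctahedral n. \<forall>i>k - 1. i \<le> n \<longrightarrow> g (signed_point n i) = signed_point n i}"
      using r(1) by blast
  qed
qed

lemma hyperoctahedral_gens_signed_gen:
  assumes "n \<ge> 1"
  shows "hyperoctahedral_gens n = signed_gen n ` {1..n}"
proof (intro equalityI subsetI)
  fix s assume "s \<in> hyperoctahedral_gens n"
  then consider "s = signed_swap (int n) (- int n)"
    | i where "s = signed_swap i (i + 1)" "1 \<le> i" "i \<le> int n - 1"
    unfolding hyperoctahedral_gens_eq by blast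
  then show "s \<in> signed_gen n ` {1..n}"
  proof cases
    case 1
    then show ?thesis using assms by (intro image_eqI[of _ _ 1]) (auto simp: signed_gen_def)
  next
    case (2 i)
    then show ?thesis
      by (intro image_eqI[of _ _ "nat (int n - i + 1)"]) (auto simp: signed_gen_def add.commute)
  qed
next
  fix s assume "s \<in> signed_gen n ` {1..n}"
  then obtain i where i: "1 \<le> i" "i \<le> n" "s = signed_gen n i" by auto
  show "s \<in> hyperoctahedral_gens n"
  proof (cases "i = 1")
    case True
    then show ?thesis unfolding hyperoctahedral_gens_eq i(3) by (simp add: signed_gen_def)
  next
    case False
    then have "s = signed_swap (int n - int i + 1) (int n - int i + 1 + 1)"
      unfolding i(3) by (simp add: signed_gen_def add.commute)
    moreover have "1 \<le> int n - int i + 1" "int n - int i + 1 \<le> int n - 1" using i False by auto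
    ultimately show ?thesis unfolding hyperoctahedral_gens_eq by blast
  qed
qed

lemma coxeter_system_hyperoctahedral:
  assumes "n \<ge> 1"
  shows "coxeter_system (hyperoctahedral_group n) (hyperoctahedral_gens n)"
proof -
  interpret coxeter_path_normal_forms "signed_gen n" n 2 signed_suffixes "signed_point n"
    "\<lambda>k. {g \<in> hyperoctahedral n. \<forall>i. k < i \<longrightarrow> i \<le> n \<longrightarrow> g (signed_point n i) = signed_point n i}"
    by (rule coxeter_path_normal_forms_signed)
  show ?thesis
    unfolding hyperoctahedral_gens_signed_gen[OF assms]
  proof (rule coxeter_system_path[OF group_hyperoctahedral _ _ word_prod_hyperoctahedral])
    show "signed_gen n ` {1..n} \<subseteq> carrier (hyperoctahedral_group n)"
      using signed_gen_hyperoctahedral by auto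
  qed auto
qed

text \<open>The last conjunct sharpens the existential one before it: the Coxeter structure on the
  subgroup is the standard one, identified through \<open>id\<close>.\<close>

theorem theorem4p3:
  fixes n :: nat
  assumes "n \<ge> 2"
  shows "subgroup (hyperoctahedral n) (sym_Omega n) \<and>
    \<not> modular (sym_Omega n) (sym_Omega_gens n) (hyperoctahedral n) \<and>
    quasi_modular (sym_Omega n) (sym_Omega_gens n) (hyperoctahedral n) \<and>
    quasi_modular_via (sym_Omega n) (sym_Omega_gens n) (hyperoctahedral n)
      (hyperoctahedral_group n) (hyperoctahedral_gens n) id"
proof -
  have n: "n \<ge> 1" using assms by simp
  have "id \<in> iso (hyperoctahedral_group n) (sym_Omega n\<lparr>carrier := hyperoctahedral n\<rparr>)"
    unfolding hyperoctahedral_group_eq by (rule iso_set_refl[unfolded id_def[symmetric]])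
  then have "quasi_modular_via (sym_Omega n) (sym_Omega_gens n) (hyperoctahedral n)
      (hyperoctahedral_group n) (hyperoctahedral_gens n) id"
    unfolding quasi_modular_via_def Let_def hyperoctahedral_group_eq image_id id_apply
      reflections_sym_Omega[OF n] reflections_hyperoctahedral[OF assms]
      abs_length_sym_Omega abs_length_hyperoctahedral
    using coxeter_system_sym_Omega[OF n] coxeter_system_hyperoctahedral[OF n] subgroup_hyperoctahedral
      length_poly_factorization finite_permutations[OF finite_Omega]
    by simp
  then show ?thesis
    unfolding quasi_modular_def
    using subgroup_hyperoctahedral not_modular_hyperoctahedral[OF assms] by blast
qed

end
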